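(* Let $n$ be a positive integer. For each of the following rows, there is a bijection between any two of the sets listed in that row: (a) $(\mathcal{NG}\text{-}1)_n$, $(\mathcal{NG}\text{-}2)_n$, $\mathcal{S}_{n-1}$; (b) $(\mathcal{NG}\text{-}1\cap\mathcal{NG}\text{-}2)_n$, $\mathcal{B}_{n-1}$; (c) $(\mathcal{NG}\text{-}1\setminus\mathcal{NG}\text{-}2)_n$, $(\mathcal{NG}\text{-}2\setminus\mathcal{NG}\text{-}1)_n$, $\mathcal{U}_{n-1}$, $\mathcal{T}_{\le n-2}$; (d) $(\mathcal{NG}\text{-}3)_n$, $\mathcal{U}_{n-4}$, $\mathcal{T}_{\le n-5}$.
   Context: All graphs are finite, simple and unlabeled (i.e., considered up to isomorphism). For a class $\mathcal{C}$, $\mathcal{C}_k$ denotes the set of graphs in $\mathcal{C}$ with $k$ vertices; sets with negative index are empty. $\chi,\omega,\alpha$ are chromatic, clique and independence numbers. A graph $G$ is an NG-graph if $\chi(G)+\chi(\overline{G})=|V(G)|+1$; its ABC-partition is $A=\{v:\deg(v)=\chi(G)-1\}$, $B=\{v:\deg(v)>\chi(G)-1\}$, $C=\{v:\deg(v)<\chi(G)-1\}$. $\mathcal{NG}\text{-}1$, $\mathcal{NG}\text{-}2$, $\mathcal{NG}\text{-}3$ are the sets of NG-graphs with $G[A]$ a clique, a stable set, a 5-cycle, respectively. $\mathcal{S}$ is the set of split graphs (graphs whose vertex set partitions as $K\cup S$ with $K$ a clique and $S$ a stable set), including the graph with $0$ vertices, so $|\mathcal{S}_0|=1$. A split graph is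 balanced if it has such a partition with $|K|=\omega(G)$ and $|S|=\alpha(G)$, unbalanced otherwise; $\mathcal{B}$ and $\mathcal{U}$ are the sets of balanced and unbalanced split graphs (the null graph is balanced). $\mathcal{T}_{\le k}=\mathcal{S}_0\cup\mathcal{S}_1\cup\cdots\cup\mathcal{S}_k$ is the set of split graphs on at most $k$ vertices. *)

theory Defs
  imports "HOL-Library.Ramsey"
begin

section \<open>Finite simple graphs\<close>

type_synonym 'a graph = "'a set \<times> 'a set set"

abbreviation verts :: "'a graph \<Rightarrow> 'a set" where
  "verts \<equiv> fst"

abbreviation edges :: "'a graph \<Rightarrow> 'a set set" where
  "edges \<equiv> snd"

definition simple_graph :: "'a graph \<Rightarrow> bool" where
  "simple_graph G \<longleftrightarrow> finite (verts G) \<and> edges G \<subseteq> [verts G]\<^bsup>2\<^esup>"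

definition complement :: "'a graph \<Rightarrow> 'a graph" where
  "complement G = (verts G, [verts G]\<^bsup>2\<^esup> - edges G)"

definition induced :: "'a graph \<Rightarrow> 'a set \<Rightarrow> 'a graph" where
  "induced G X = (X, {e \<in> edges G. e \<subseteq> X})"

definition deg :: "'a graph \<Rightarrow> 'a \<Rightarrow> nat" where
  "deg G v = card {e \<in> edges G. v \<in> e}"

definition isomorphic :: "'a graph \<Rightarrow> 'b graph \<Rightarrow> bool" where
  "isomorphic G H \<longleftrightarrow>
     (\<exists>f. bij_betw f (verts G) (verts H) \<and>
          (\<forall>u\<in>verts G. \<forall>v\<in>verts G. {u, v} \<in> edges G \<longleftrightarrow> {f u, f v} \<in> edges H))"

definition colorable :: "'a graph \<Rightarrow> nat \<Rightarrow> bool" where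
  "colorable G k \<longleftrightarrow>
     (\<exists>c :: 'a \<Rightarrow> nat. c ` verts G \<subseteq> {..<k} \<and>
        (\<forall>u\<in>verts G. \<forall>v\<in>verts G. {u, v} \<in> edges G \<longrightarrow> c u \<noteq> c v))"

definition chromatic_number :: "'a graph \<Rightarrow> nat" where
  "chromatic_number G = (LEAST k. colorable G k)"

definition clique_number :: "'a graph \<Rightarrow> nat" where
  "clique_number G = Max {card K | K. K \<subseteq> verts G \<and> clique K (edges G)}"

definition independence_number :: "'a graph \<Rightarrow> nat" where
  "independence_number G = Max {card S | S. S \<subseteq> verts G \<and> indep S (edges G)}"

definition cycle5 :: "nat graph" where
  "cycle5 = ({..<5}, {{i, (i + 1) mod 5} | i. i < 5})"


section \<open>NG-graphs\<close>

definition NG_graph :: "'a graph \<Rightarrow> bool" where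
  "NG_graph G \<longleftrightarrow>
     chromatic_number G + chromatic_number (complement G) = card (verts G) + 1"

text \<open>The part \<open>A\<close> of the ABC-partition. On an NG-graph the chromatic number is
  positive, since the null graph is not an NG-graph, so the subtraction does not truncate.\<close>

definition A_part :: "'a graph \<Rightarrow> 'a set" where
  "A_part G = {v \<in> verts G. deg G v = chromatic_number G - 1}"

definition NG1_graph :: "'a graph \<Rightarrow> bool" where
  "NG1_graph G \<longleftrightarrow> NG_graph G \<and> clique (A_part G) (edges G)"

definition NG2_graph :: "'a graph \<Rightarrow> bool" where
  "NG2_graph G \<longleftrightarrow> NG_graph G \<and> indep (A_part G) (edges G)"

definition NG3_graph :: "'a graph \<Rightarrow> bool" where
  "NG3_graph G \<longleftrightarrow> NG_graph G \<and> isomorphic (induced G (A_part G)) cycle5"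


section \<open>Split graphs\<close>

definition split_partition :: "'a graph \<Rightarrow> 'a set \<Rightarrow> 'a set \<Rightarrow> bool" where
  "split_partition G K S \<longleftrightarrow>
     K \<union> S = verts G \<and> K \<inter> S = {} \<and> clique K (edges G) \<and> indep S (edges G)"

definition split_graph :: "'a graph \<Rightarrow> bool" where
  "split_graph G \<longleftrightarrow> (\<exists>K S. split_partition G K S)"

definition balanced_split :: "'a graph \<Rightarrow> bool" where
  "balanced_split G \<longleftrightarrow>
     (\<exists>K S. split_partition G K S \<and>
            card K = clique_number G \<and> card S = independence_number G)"

definition unbalanced_split :: "'a graph \<Rightarrow> bool" where
  "unbalanced_split G \<longleftrightarrow> split_graph G \<and> \<not> balanced_split G"


section \<open>Unlabeled graphs\<close>

text \<open>An unlabeled graph is an isomorphism class of simple graphs with vertices in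
  \<^typ>\<open>nat\<close>; every finite graph is isomorphic to one of these.\<close>

type_synonym ugraph = "nat graph set"

definition iso_rel :: "nat graph rel" where
  "iso_rel = {(G, H). simple_graph G \<and> simple_graph H \<and> isomorphic G H}"

definition unlabeled :: "(nat graph \<Rightarrow> bool) \<Rightarrow> ugraph set" where
  "unlabeled P = {G. simple_graph G \<and> P G} // iso_rel"

text \<open>The order is an integer, so that negative indices are allowed and give the empty set.\<close>

definition of_order :: "ugraph set \<Rightarrow> int \<Rightarrow> ugraph set" where
  "of_order \<C> k = {X \<in> \<C>. \<exists>G\<in>X. int (card (verts G)) = k}"

definition NG1 :: "ugraph set" where "NG1 = unlabeled NG1_graph"
definition NG2 :: "ugraph set" where "NG2 = unlabeled NG2_graph"
definition NG3 :: "ugraph set" where "NG3 = unlabeled NG3_graph"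
definition Split :: "ugraph set" where "Split = unlabeled split_graph"
definition Balanced :: "ugraph set" where "Balanced = unlabeled balanced_split"
definition Unbalanced :: "ugraph set" where "Unbalanced = unlabeled unbalanced_split"

definition Split_upto :: "int \<Rightarrow> ugraph set" where
  "Split_upto k = (\<Union>j\<in>{0..k}. of_order Split j)"

definition pairwise_bijective :: "'a set set \<Rightarrow> bool" where
  "pairwise_bijective F \<longleftrightarrow> (\<forall>X\<in>F. \<forall>Y\<in>F. \<exists>f. bij_betw f X Y)"

lemma isomorphic_refl: "isomorphic G G"
  unfolding isomorphic_def by (rule exI[of _ id]) simp

lemma isomorphic_sym:
  assumes "isomorphic G H"
  shows "isomorphic H G"
proof -
  obtain f where f: "bij_betw f (verts G) (verts H)"
    and E: "\<And>u v. u \<in> verts G \<Longrightarrow> v \<in> verts G \<Longrightarrow> {u, v} \<in> edges G \<longleftrightarrow> {f u, f v} \<in> edges H"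
    using assms unfolding isomorphic_def by blast
  let ?g = "inv_into (verts G) f"
  have g: "bij_betw ?g (verts H) (verts G)"
    using f by (rule bij_betw_inv_into)
  have "{u, v} \<in> edges H \<longleftrightarrow> {?g u, ?g v} \<in> edges G"
    if "u \<in> verts H" "v \<in> verts H" for u v
    using E[of "?g u" "?g v"] that bij_betwE[OF g] bij_betw_inv_into_right[OF f] by simp
  with g show ?thesis
    unfolding isomorphic_def by blast
qed

lemma isomorphic_trans:
  assumes "isomorphic G H" "isomorphic H K"
  shows "isomorphic G K"
proof -
  obtain f where f: "bij_betw f (verts G) (verts H)"
    and E: "\<And>u v. u \<in> verts G \<Longrightarrow> v \<in> verts G \<Longrightarrow> {u, v} \<in> edges G \<longleftrightarrow> {f u, f v} \<in> edges H"
    using assms(1) unfolding isomorphic_def by blast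
  obtain g where g: "bij_betw g (verts H) (verts K)"
    and F: "\<And>u v. u \<in> verts H \<Longrightarrow> v \<in> verts H \<Longrightarrow> {u, v} \<in> edges H \<longleftrightarrow> {g u, g v} \<in> edges K"
    using assms(2) unfolding isomorphic_def by blast
  have "{u, v} \<in> edges G \<longleftrightarrow> {(g \<circ> f) u, (g \<circ> f) v} \<in> edges K"
    if "u \<in> verts G" "v \<in> verts G" for u v
    using E F that bij_betwE[OF f] by simp
  with bij_betw_trans[OF f g] show ?thesis
    unfolding isomorphic_def by blast
qed

lemma equiv_iso_rel: "equiv {G. simple_graph G} iso_rel"
  by (rule equivI)
    (auto simp: iso_rel_def refl_on_def
      intro!: symI transI intro: isomorphic_refl isomorphic_sym isomorphic_trans)

end

theory Submission
  imports Defs "HOL-Library.Equipollence" "HOL-Combinatorics.Transposition"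
begin

text \<open>Let \<open>P\<close> be a minimal vertex set inducing a subgraph of \<open>G\<close> that is not
  \<open>(\<chi>(G) - 1)\<close>-colourable, and \<open>Q\<close> the analogous set for the complement. In an
  NG-graph these sets are so large that \<open>D = P \<inter> Q\<close> is nonempty, and minimality forces every
  degree inequality at a vertex of \<open>D\<close> to be an equality. Hence \<open>D\<close> is a regular hub: it is
  completely joined to the clique \<open>K = P - D\<close>, not joined at all to the stable set
  \<open>S = Q - D\<close>, and \<open>K\<close>, \<open>S\<close> and \<open>D\<close> cover \<open>G\<close>. If the hub is a clique or a stable
  set, a single vertex of it is a hub as well, and graphs with a one-vertex hub are exactly the
  unbalanced split graphs; the only other hub inside a 5-cycle is the whole 5-cycle.

  All vertices that can serve as a one-vertex hub are twins, so deleting the hub is well defined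
  on isomorphism classes; on \<open>NG-1\<close> it is a bijection onto the split graphs with one vertex
  fewer, and complementation exchanges \<open>NG-1\<close> and \<open>NG-2\<close>. Contracting a 5-cycle hub to
  a single vertex maps \<open>NG-3\<close> bijectively onto the unbalanced split graphs. Finally, the
  unbalanced split graphs of order \<open>m\<close> are the disjoint union of \<open>NG-1\<close> and
  \<open>NG-2 - NG-1\<close>, which correspond to the split graphs and the unbalanced split graphs of
  order \<open>m - 1\<close>; iterating gives all split graphs of order less than \<open>m\<close>.\<close>

section \<open>Graphs and isomorphisms\<close>

lemma simple_graph_edgeD:
  assumes "simple_graph G" "{u, v} \<in> edges G"
  shows "u \<in> verts G" "v \<in> verts G" "u \<noteq> v"
proof -
  have "{u, v} \<in> [verts G]\<^bsup>2\<^esup>"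
    using assms unfolding simple_graph_def by blast
  then show "u \<in> verts G" "v \<in> verts G" "u \<noteq> v"
    by (auto simp: nsets_def)
qed

lemma finite_verts: "simple_graph G \<Longrightarrow> finite (verts G)"
  by (simp add: simple_graph_def)

lemma simple_graph_no_loop: "simple_graph G \<Longrightarrow> {v} \<notin> edges G"
  using simple_graph_edgeD(3)[of G v v] by auto

text \<open>An edge through \<open>v\<close> is determined by its other end. Counting neighbours
  instead of edges lets degrees be split over vertex sets.\<close>

lemma deg_conv_neighbours:
  assumes "simple_graph G"
  shows "deg G v = card {u \<in> verts G. {u, v} \<in> edges G}"
proof -
  have "bij_betw (\<lambda>u. {u, v}) {u \<in> verts G. {u, v} \<in> edges G} {e \<in> edges G. v \<in> e}"
    unfolding bij_betw_def
  proof
    show "inj_on (\<lambda>u. {u, v}) {u \<in> verts G. {u, v} \<in> edges G}"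
      by (auto simp: inj_on_def doubleton_eq_iff)
    show "(\<lambda>u. {u, v}) ` {u \<in> verts G. {u, v} \<in> edges G} = {e \<in> edges G. v \<in> e}"
    proof
      show "{e \<in> edges G. v \<in> e} \<subseteq> (\<lambda>u. {u, v}) ` {u \<in> verts G. {u, v} \<in> edges G}"
      proof
        fix e assume e: "e \<in> {e \<in> edges G. v \<in> e}"
        then have "e \<in> [verts G]\<^bsup>2\<^esup>"
          using assms unfolding simple_graph_def by blast
        then obtain x y where "e = {x, y}" "x \<noteq> y" "x \<in> verts G" "y \<in> verts G"
          by (auto simp: nsets_def card_2_iff)
        then show "e \<in> (\<lambda>u. {u, v}) ` {u \<in> verts G. {u, v} \<in> edges G}"
          using e by (auto simp: insert_commute image_iff doubleton_eq_iff)
      qed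
    qed auto
  qed
  then show ?thesis
    by (simp add: deg_def bij_betw_same_card)
qed

section \<open>Complements and induced subgraphs\<close>

lemma verts_complement [simp]: "verts (complement G) = verts G"
  by (simp add: complement_def)

lemma simple_graph_complement: "simple_graph G \<Longrightarrow> simple_graph (complement G)"
  by (auto simp: simple_graph_def complement_def)

lemma edges_complement:
  "{u, v} \<in> edges (complement G) \<longleftrightarrow>
     u \<in> verts G \<and> v \<in> verts G \<and> u \<noteq> v \<and> {u, v} \<notin> edges G"
  by (auto simp: complement_def nsets_def)

lemma complement_complement: "simple_graph G \<Longrightarrow> complement (complement G) = G"
  by (cases G) (auto simp: simple_graph_def complement_def)

lemma verts_induced [simp]: "verts (induced G X) = X"
  by (simp add: induced_def)

lemma edges_induced: "{u, v} \<in> edges (induced G X) \<longleftrightarrow> u \<in> X \<and> v \<in> X \<and> {u, v} \<in> edges G"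
  by (auto simp: induced_def)

lemma simple_graph_induced:
  "simple_graph G \<Longrightarrow> X \<subseteq> verts G \<Longrightarrow> simple_graph (induced G X)"
  by (auto simp: simple_graph_def induced_def nsets_def intro: finite_subset)

lemma complement_induced:
  "X \<subseteq> verts G \<Longrightarrow> complement (induced G X) = induced (complement G) X"
  by (auto simp: complement_def induced_def nsets_def)

lemma clique_complement:
  assumes "X \<subseteq> verts G"
  shows "clique X (edges (complement G)) \<longleftrightarrow> indep X (edges G)"
  using assms by (auto simp: clique_def indep_def edges_complement subset_iff)

lemma indep_complement:
  assumes "X \<subseteq> verts G"
  shows "indep X (edges (complement G)) \<longleftrightarrow> clique X (edges G)"
  using assms by (auto simp: clique_def indep_def edges_complement subset_iff)

lemma clique_number_complement: "clique_number (complement G) = independence_number G"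
proof -
  have "{card K | K. K \<subseteq> verts G \<and> clique K (edges (complement G))} =
        {card S | S. S \<subseteq> verts G \<and> indep S (edges G)}"
    using clique_complement by blast
  then show ?thesis
    unfolding clique_number_def independence_number_def by simp
qed

text \<open>Two distinct vertices cannot be both adjacent and non-adjacent. This bounds the overlap
  of a clique with the stable side of a split graph.\<close>

lemma card_clique_indep_le_1:
  assumes "clique X E" "indep Y E" "X \<subseteq> Y"
  shows "X = {} \<or> (\<exists>x. X = {x})"
  using assms unfolding clique_def indep_def by blast

text \<open>Naming the map keeps track of where particular vertex sets go, which the existential
  \<open>isomorphic\<close> hides.\<close>

definition graph_iso :: "('a \<Rightarrow> 'b) \<Rightarrow> 'a graph \<Rightarrow> 'b graph \<Rightarrow> bool" where
  "graph_iso f G H \<longleftrightarrow> bij_betw f (verts G) (verts H) \<and>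
     (\<forall>u\<in>verts G. \<forall>v\<in>verts G. {u, v} \<in> edges G \<longleftrightarrow> {f u, f v} \<in> edges H)"

lemma isomorphicI: "graph_iso f G H \<Longrightarrow> isomorphic G H"
  unfolding isomorphic_def graph_iso_def by blast

lemma isomorphicE:
  assumes "isomorphic G H"
  obtains f where "graph_iso f G H"
  using assms unfolding isomorphic_def graph_iso_def by blast

lemma graph_iso_edge:
  "graph_iso f G H \<Longrightarrow> u \<in> verts G \<Longrightarrow> v \<in> verts G \<Longrightarrow> {f u, f v} \<in> edges H \<longleftrightarrow> {u, v} \<in> edges G"
  by (simp add: graph_iso_def)

lemma graph_iso_image: "graph_iso f G H \<Longrightarrow> f ` verts G = verts H"
  by (simp add: graph_iso_def bij_betw_def)

lemma graph_iso_inj: "graph_iso f G H \<Longrightarrow> inj_on f (verts G)"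
  by (simp add: graph_iso_def bij_betw_def)

lemma graph_iso_comp: "graph_iso f G H \<Longrightarrow> graph_iso h H J \<Longrightarrow> graph_iso (h \<circ> f) G J"
  unfolding graph_iso_def by (auto intro: bij_betw_trans dest: bij_betwE)

lemma isomorphic_card: "isomorphic G H \<Longrightarrow> card (verts G) = card (verts H)"
  by (auto simp: isomorphic_def intro: bij_betw_same_card)

lemma graph_iso_complement:
  assumes "graph_iso f G H"
  shows "graph_iso f (complement G) (complement H)"
proof -
  have "f u \<in> verts H \<and> f v \<in> verts H \<and> (f u = f v \<longleftrightarrow> u = v)"
    if "u \<in> verts G" "v \<in> verts G" for u v
    using that graph_iso_image[OF assms] graph_iso_inj[OF assms] by (auto simp: inj_on_def)
  with assms show ?thesis
    by (auto simp: graph_iso_def edges_complement)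
qed

lemma isomorphic_complement_iff:
  assumes "simple_graph G" "simple_graph H"
  shows "isomorphic (complement G) (complement H) \<longleftrightarrow> isomorphic G H"
  using graph_iso_complement complement_complement[OF assms(1)] complement_complement[OF assms(2)]
  by (metis isomorphicE isomorphicI)

lemma graph_iso_induced:
  assumes "graph_iso f G H" "X \<subseteq> verts G"
  shows "graph_iso f (induced G X) (induced H (f ` X))"
proof -
  have "inj_on f X"
    using assms graph_iso_inj inj_on_subset by blast
  then show ?thesis
    using assms by (auto simp: graph_iso_def edges_induced bij_betw_def subset_iff)
qed

lemma clique_graph_iso:
  assumes "graph_iso f G H" "X \<subseteq> verts G"
  shows "clique (f ` X) (edges H) \<longleftrightarrow> clique X (edges G)"
proof -
  have "f u = f v \<longleftrightarrow> u = v" "{f u, f v} \<in> edges H \<longleftrightarrow> {u, v} \<in> edges G"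
    if "u \<in> X" "v \<in> X" for u v
    using that graph_iso_edge[OF assms(1), of u v] inj_onD[OF graph_iso_inj[OF assms(1)], of u v]
      assms(2) by blast+
  then show ?thesis
    by (auto simp: clique_def)
qed

lemma indep_graph_iso:
  assumes "graph_iso f G H" "X \<subseteq> verts G"
  shows "indep (f ` X) (edges H) \<longleftrightarrow> indep X (edges G)"
proof -
  have "f u = f v \<longleftrightarrow> u = v" "{f u, f v} \<in> edges H \<longleftrightarrow> {u, v} \<in> edges G"
    if "u \<in> X" "v \<in> X" for u v
    using that graph_iso_edge[OF assms(1), of u v] inj_onD[OF graph_iso_inj[OF assms(1)], of u v]
      assms(2) by blast+
  then show ?thesis
    by (auto simp: indep_def)
qed

section \<open>Invariance of colourings, degrees, the part A and clique numbers\<close>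

lemma colorable_if_isomorphic:
  assumes "isomorphic G H" "colorable H k"
  shows "colorable G k"
proof -
  obtain f where f: "graph_iso f G H"
    using assms(1) by (rule isomorphicE)
  obtain c where c: "c ` verts H \<subseteq> {..<k}"
    "\<forall>u\<in>verts H. \<forall>v\<in>verts H. {u, v} \<in> edges H \<longrightarrow> c u \<noteq> c v"
    using assms(2) unfolding colorable_def by blast
  have "f u \<in> verts H" if "u \<in> verts G" for u
    using that graph_iso_image[OF f] by blast
  then show ?thesis
    using c graph_iso_edge[OF f] unfolding colorable_def
    by (intro exI[of _ "c \<circ> f"]) (auto simp: image_subset_iff)
qed

lemma chromatic_number_isomorphic:
  assumes "isomorphic G H"
  shows "chromatic_number G = chromatic_number H"
proof -
  have "colorable G k \<longleftrightarrow> colorable H k" for k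
    using colorable_if_isomorphic[OF assms] colorable_if_isomorphic[OF isomorphic_sym[OF assms]]
    by blast
  then show ?thesis
    by (simp add: chromatic_number_def)
qed

lemma deg_graph_iso:
  assumes "graph_iso f G H" "simple_graph G" "simple_graph H" "v \<in> verts G"
  shows "deg H (f v) = deg G v"
proof -
  have "{u \<in> verts H. {u, f v} \<in> edges H} = f ` {u \<in> verts G. {u, v} \<in> edges G}"
    unfolding graph_iso_image[OF assms(1), symmetric]
    using graph_iso_edge[OF assms(1) _ assms(4)] by auto
  moreover have "inj_on f {u \<in> verts G. {u, v} \<in> edges G}"
    using graph_iso_inj[OF assms(1)] by (rule inj_on_subset) auto
  ultimately show ?thesis
    using assms by (simp add: deg_conv_neighbours card_image)
qed

lemma A_part_graph_iso:
  assumes "graph_iso f G H" "simple_graph G" "simple_graph H"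
  shows "A_part H = f ` A_part G"
proof -
  have chi: "chromatic_number G = chromatic_number H"
    using chromatic_number_isomorphic[OF isomorphicI[OF assms(1)]] .
  have iff: "f v \<in> A_part H \<longleftrightarrow> v \<in> A_part G" if "v \<in> verts G" for v
  proof -
    have "f v \<in> verts H"
      using that graph_iso_image[OF assms(1)] by blast
    then show ?thesis
      using that unfolding A_part_def by (simp add: chi deg_graph_iso[OF assms that])
  qed
  show ?thesis
  proof (intro equalityI subsetI)
    fix y assume y: "y \<in> A_part H"
    then have "y \<in> f ` verts G"
      using graph_iso_image[OF assms(1)] by (simp add: A_part_def)
    then obtain v where "v \<in> verts G" "y = f v" by (rule imageE)
    then show "y \<in> f ` A_part G"
      using iff y by simp
  next
    fix y assume "y \<in> f ` A_part G"
    then obtain v where v: "v \<in> A_part G" "y = f v" by (rule imageE)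
    then have "v \<in> verts G" by (simp add: A_part_def)
    then show "y \<in> A_part H"
      using iff v by simp
  qed
qed

lemma A_part_subset: "A_part G \<subseteq> verts G"
  by (auto simp: A_part_def)

lemma NG_graph_isomorphic:
  assumes "isomorphic G H"
  shows "NG_graph G \<longleftrightarrow> NG_graph H"
proof -
  obtain f where f: "graph_iso f G H"
    using assms by (rule isomorphicE)
  from chromatic_number_isomorphic[OF isomorphicI[OF graph_iso_complement[OF f]]] show ?thesis
    using chromatic_number_isomorphic[OF assms] isomorphic_card[OF assms]
    by (simp add: NG_graph_def)
qed

lemma NG1_graph_isomorphic:
  assumes "simple_graph G" "simple_graph H" "isomorphic G H"
  shows "NG1_graph G \<longleftrightarrow> NG1_graph H"
proof -
  obtain f where f: "graph_iso f G H"
    using assms(3) by (rule isomorphicE)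
  show ?thesis
    using NG_graph_isomorphic[OF assms(3)] clique_graph_iso[OF f A_part_subset]
    by (simp only: NG1_graph_def A_part_graph_iso[OF f assms(1,2)])
qed

lemma NG2_graph_isomorphic:
  assumes "simple_graph G" "simple_graph H" "isomorphic G H"
  shows "NG2_graph G \<longleftrightarrow> NG2_graph H"
proof -
  obtain f where f: "graph_iso f G H"
    using assms(3) by (rule isomorphicE)
  show ?thesis
    using NG_graph_isomorphic[OF assms(3)] indep_graph_iso[OF f A_part_subset]
    by (simp only: NG2_graph_def A_part_graph_iso[OF f assms(1,2)])
qed

lemma clique_number_isomorphic:
  assumes "isomorphic G H"
  shows "clique_number G = clique_number H"
proof -
  obtain f where f: "graph_iso f G H"
    using assms by (rule isomorphicE)
  have "{K. K \<subseteq> verts H \<and> clique K (edges H)} =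
        (`) f ` {K. K \<subseteq> verts G \<and> clique K (edges G)}"
  proof (intro equalityI subsetI)
    fix L assume "L \<in> {K. K \<subseteq> verts H \<and> clique K (edges H)}"
    then have L: "L \<subseteq> f ` verts G" "clique L (edges H)"
      using graph_iso_image[OF f] by auto
    from L(1) obtain X where X: "X \<subseteq> verts G" "L = f ` X"
      by (rule subset_imageE)
    then have "clique X (edges G)"
      using L(2) clique_graph_iso[OF f X(1)] by simp
    with X show "L \<in> (`) f ` {K. K \<subseteq> verts G \<and> clique K (edges G)}"
      by simp
  next
    fix L assume "L \<in> (`) f ` {K. K \<subseteq> verts G \<and> clique K (edges G)}"
    then obtain X where X: "X \<subseteq> verts G" "clique X (edges G)" "L = f ` X"
      by blast
    then show "L \<in> {K. K \<subseteq> verts H \<and> clique K (edges H)}"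
      using clique_graph_iso[OF f X(1)] graph_iso_image[OF f] by auto
  qed
  then have "card ` {K. K \<subseteq> verts H \<and> clique K (edges H)} =
        card ` (`) f ` {K. K \<subseteq> verts G \<and> clique K (edges G)}"
    by (rule arg_cong)
  also have "\<dots> = card ` {K. K \<subseteq> verts G \<and> clique K (edges G)}"
    unfolding image_image
    by (intro image_cong refl card_image) (use graph_iso_inj[OF f] inj_on_subset in blast)
  finally show ?thesis
    by (simp add: clique_number_def setcompr_eq_image)
qed

text \<open>The last hypothesis makes \<open>a\<close> and \<open>b\<close> twins, adjacent or not,
  so exchanging them is an automorphism. It serves to correct maps that pick the wrong one of
  several interchangeable vertices.\<close>

lemma graph_iso_transpose:
  assumes "simple_graph G" "a \<in> verts G" "b \<in> verts G"
    and "\<And>w. w \<in> verts G - {a, b} \<Longrightarrow> {w, a} \<in> edges G \<longleftrightarrow> {w, b} \<in> edges G"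
  shows "graph_iso (transpose a b) G G"
proof -
  have "bij_betw (transpose a b) (verts G) (verts G)"
    using assms(2,3) by simp
  moreover have "{u, v} \<in> edges G \<longleftrightarrow> {transpose a b u, transpose a b v} \<in> edges G"
    if "u \<in> verts G" "v \<in> verts G" for u v
  proof -
    consider "u \<notin> {a, b}" "v \<notin> {a, b}" | "u \<in> {a, b}" "v \<notin> {a, b}"
      | "u \<notin> {a, b}" "v \<in> {a, b}" | "u \<in> {a, b}" "v \<in> {a, b}"
      by blast
    then show ?thesis
    proof cases
      case 2
      then have "{v, a} \<in> edges G \<longleftrightarrow> {v, b} \<in> edges G"
        using assms(4)[of v] that by simp
      with 2 show ?thesis
        by (auto simp: insert_commute[of v])
    next
      case 3
      then have "{u, a} \<in> edges G \<longleftrightarrow> {u, b} \<in> edges G"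
        using assms(4)[of u] that by simp
      with 3 show ?thesis
        by auto
    next
      case 4
      then show ?thesis
        using simple_graph_no_loop[OF assms(1)] by (auto simp: insert_commute)
    qed simp
  qed
  ultimately show ?thesis
    by (simp add: graph_iso_def)
qed

section \<open>Colourings\<close>

lemma colorableE:
  assumes "colorable G k"
  obtains c where "c ` verts G \<subseteq> {..<k}"
    "\<And>u v. u \<in> verts G \<Longrightarrow> v \<in> verts G \<Longrightarrow> {u, v} \<in> edges G \<Longrightarrow> c u \<noteq> c v"
proof -
  from assms obtain c where c: "c ` verts G \<subseteq> {..<k} \<and>
      (\<forall>u\<in>verts G. \<forall>v\<in>verts G. {u, v} \<in> edges G \<longrightarrow> c u \<noteq> c v)"
    unfolding colorable_def by (rule exE)
  show thesis
    by (rule that[of c]) (use c in simp_all)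
qed

lemma colorable_card:
  assumes "simple_graph G"
  shows "colorable G (card (verts G))"
proof -
  obtain g where g: "bij_betw g (verts G) {..<card (verts G)}"
    using assms finite_verts ex_bij_betw_finite_nat by (metis lessThan_atLeast0)
  have "g u \<noteq> g v" if "u \<in> verts G" "v \<in> verts G" "{u, v} \<in> edges G" for u v
    using that g simple_graph_edgeD(3)[OF assms, of u v] by (auto simp: bij_betw_def inj_on_def)
  then show ?thesis
    using g unfolding colorable_def bij_betw_def by blast
qed

lemma colorable_mono: "colorable G k \<Longrightarrow> k \<le> m \<Longrightarrow> colorable G m"
  unfolding colorable_def by (meson lessThan_subset_iff order_trans)

lemma colorable_iff_chromatic_number_le:
  assumes "simple_graph G"
  shows "colorable G m \<longleftrightarrow> chromatic_number G \<le> m"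
  unfolding chromatic_number_def
  using LeastI[of "colorable G", OF colorable_card[OF assms]] colorable_mono Least_le by metis

text \<open>\<open>P\<close> is an inclusion-minimal set that \<open>m\<close> colours do not
  suffice for. If some \<open>v\<close> in it had fewer than \<open>m\<close> neighbours in
  \<open>P\<close>, an \<open>m\<close>-colouring of \<open>P - {v}\<close> would leave a colour
  free for \<open>v\<close>.\<close>

lemma ex_minimal_uncolorable:
  assumes "simple_graph G" "\<not> colorable G m"
  obtains P where "P \<subseteq> verts G" "\<not> colorable (induced G P) m" "m < card P"
    "\<And>v. v \<in> P \<Longrightarrow> m \<le> card {u \<in> P. {u, v} \<in> edges G}"
proof -
  define F where "F = {P. P \<subseteq> verts G \<and> \<not> colorable (induced G P) m}"
  have "finite F"
    unfolding F_def using finite_verts[OF assms(1)] by auto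
  moreover have "verts G \<in> F"
  proof -
    have "isomorphic G (induced G (verts G))"
      unfolding isomorphic_def by (rule exI[of _ id]) (auto simp: edges_induced)
    then show ?thesis
      unfolding F_def using assms(2) colorable_if_isomorphic by blast
  qed
  ultimately obtain P where P: "P \<in> F" and min: "\<And>Q. Q \<in> F \<Longrightarrow> Q \<subseteq> P \<Longrightarrow> Q = P"
    using finite_has_minimal2[of F] by metis
  have PV: "P \<subseteq> verts G" and nc: "\<not> colorable (induced G P) m"
    using P by (auto simp: F_def)
  have fin: "finite P"
    using PV finite_verts[OF assms(1)] finite_subset by blast
  show thesis
  proof (rule that[OF PV nc])
    show "m < card P"
      using colorable_card[OF simple_graph_induced[OF assms(1) PV]] nc colorable_mono
      by (metis verts_induced not_le)
    fix v assume v: "v \<in> P"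
    show "m \<le> card {u \<in> P. {u, v} \<in> edges G}"
    proof (rule ccontr)
      assume less: "\<not> m \<le> card {u \<in> P. {u, v} \<in> edges G}"
      have "P - {v} \<notin> F"
        using min[of "P - {v}"] v by blast
      then have "colorable (induced G (P - {v})) m"
        using PV by (auto simp: F_def)
      then obtain c where c: "c ` (P - {v}) \<subseteq> {..<m}"
        "\<And>u w. u \<in> P - {v} \<Longrightarrow> w \<in> P - {v} \<Longrightarrow> {u, w} \<in> edges G \<Longrightarrow> c u \<noteq> c w"
        unfolding colorable_def by (auto simp: edges_induced)
      have "card (c ` {u \<in> P. {u, v} \<in> edges G}) < m"
        using less card_image_le[of "{u \<in> P. {u, v} \<in> edges G}" c] fin by auto
      then have "\<not> {..<m} \<subseteq> c ` {u \<in> P. {u, v} \<in> edges G}"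
        using card_mono[of "c ` {u \<in> P. {u, v} \<in> edges G}" "{..<m}"] fin by auto
      then obtain t where t: "t < m" "t \<notin> c ` {u \<in> P. {u, v} \<in> edges G}"
        by blast
      have "colorable (induced G P) m"
        unfolding colorable_def
      proof (intro exI conjI ballI impI)
        show "(c(v := t)) ` verts (induced G P) \<subseteq> {..<m}"
          using c(1) t(1) by auto
        fix x y assume "x \<in> verts (induced G P)" "y \<in> verts (induced G P)"
          "{x, y} \<in> edges (induced G P)"
        then show "(c(v := t)) x \<noteq> (c(v := t)) y"
          using c(2)[of x y] t(2) simple_graph_no_loop[OF assms(1)]
          by (auto simp: edges_induced insert_commute)
      qed
      then show False using nc by blast
    qed
  qed
qed

text \<open>If two vertices outside \<open>D\<close> were non-adjacent, they could share a colour; every vertex of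
  \<open>D\<close> then sees at most \<open>m - 1\<close> colours, so colouring \<open>D\<close> greedily would use only \<open>m\<close> colours.\<close>

lemma clique_outside_low_degree:
  assumes "simple_graph G" "P \<subseteq> verts G" "\<not> colorable (induced G P) m"
    and "D \<subseteq> P" "D \<noteq> {}"
    and low: "\<And>v. v \<in> D \<Longrightarrow> card {u \<in> P. {u, v} \<in> edges G} \<le> m"
    and join: "\<And>u v. u \<in> P - D \<Longrightarrow> v \<in> D \<Longrightarrow> {u, v} \<in> edges G"
  shows "clique (P - D) (edges G)"
proof (rule ccontr)
  assume "\<not> clique (P - D) (edges G)"
  then obtain a b where ab: "a \<in> P - D" "b \<in> P - D" "a \<noteq> b" "{a, b} \<notin> edges G"
    by (auto simp: clique_def)
  have fin: "finite P"
    using assms(1,2) finite_verts finite_subset by blast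
  obtain d where d: "d \<in> D"
    using assms(5) by blast
  have "card (P - D) \<le> card {u \<in> P. {u, d} \<in> edges G}"
    using fin join[OF _ d] by (intro card_mono) auto
  then have "card (P - D) \<le> m"
    using low[OF d] by simp
  then have "card (P - D - {b}) \<le> m"
    by (metis Diff_subset card_mono fin finite_Diff order_trans)
  \<comment> \<open>\<open>b\<close> is left out of the numbering because it will share the colour
    of \<open>a\<close>.\<close>
  moreover obtain g where g: "bij_betw g (P - D - {b}) {..<card (P - D - {b})}"
    using fin ex_bij_betw_finite_nat[of "P - D - {b}"] by (metis finite_Diff lessThan_atLeast0)
  ultimately have gm: "g ` (P - D - {b}) \<subseteq> {..<m}" and gi: "inj_on g (P - D - {b})"
    by (auto simp: bij_betw_def)
  \<comment> \<open>Invariant of the greedy extension over \<open>D\<close>. The equality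
    \<open>c a = c b\<close> survives, since only vertices of \<open>D\<close> are given new
    colours.\<close>
  define proper where "proper c W \<longleftrightarrow> c ` W \<subseteq> {..<m} \<and> c a = c b \<and>
     (\<forall>u\<in>W. \<forall>v\<in>W. {u, v} \<in> edges G \<longrightarrow> c u \<noteq> c v)" for c :: "'a \<Rightarrow> nat" and W
  have base: "proper (g(b := g a)) (P - D)"
    unfolding proper_def
  proof (intro conjI ballI impI)
    show "(g(b := g a)) ` (P - D) \<subseteq> {..<m}"
      using gm ab by auto
    show "(g(b := g a)) a = (g(b := g a)) b"
      by simp
    fix u v assume "u \<in> P - D" "v \<in> P - D" "{u, v} \<in> edges G"
    then show "(g(b := g a)) u \<noteq> (g(b := g a)) v"
      using inj_onD[OF gi, of u v] inj_onD[OF gi, of a v] inj_onD[OF gi, of u a]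
        ab simple_graph_edgeD(3)[OF assms(1), of u v]
      by (cases "u = b"; cases "v = b") (auto simp: insert_commute)
  qed
  have finD: "finite D"
    using assms(4) fin finite_subset by blast
  have "F \<subseteq> D \<Longrightarrow> \<exists>c. proper c (P - D \<union> F)" if "finite F" for F
    using that
  proof (induction F)
    case empty
    then show ?case using base by auto
  next
    case (insert v F)
    then obtain c where c: "proper c (P - D \<union> F)" by auto
    have v: "v \<in> D" "v \<notin> F" using insert by auto
    let ?N = "{u \<in> P. {u, v} \<in> edges G}"
    have aN: "a \<in> ?N" "b \<in> ?N"
      using join v ab by auto
    have "c b = c a"
      using c by (simp add: proper_def)
    \<comment> \<open>Both \<open>a\<close> and \<open>b\<close> are neighbours of \<open>v\<close>,
      so the neighbourhood shows fewer colours than it has vertices, and one of the \<open>m\<close>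
      colours stays free.\<close>
    then have "c b \<in> c ` (?N - {b})"
      using aN ab by (intro image_eqI[of _ _ a]) auto
    then have "c ` ?N = c ` (?N - {b})"
      using aN(2) by blast
    also have "card \<dots> \<le> card (?N - {b})"
      using fin by (intro card_image_le) auto
    also have "\<dots> < card ?N"
      using aN(2) fin by (intro card_Diff1_less) auto
    also have "\<dots> \<le> m"
      using low v by simp
    finally have "\<not> {..<m} \<subseteq> c ` ?N"
      using card_mono[of "c ` ?N" "{..<m}"] fin by auto
    then obtain t where t: "t < m" "t \<notin> c ` ?N"
      by blast
    have "proper (c(v := t)) (P - D \<union> insert v F)"
      unfolding proper_def
    proof (intro conjI ballI impI)
      show "(c(v := t)) ` (P - D \<union> insert v F) \<subseteq> {..<m}"
        using c t(1) unfolding proper_def by auto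
      show "(c(v := t)) a = (c(v := t)) b"
        using c ab v unfolding proper_def by auto
      fix x y assume xy: "x \<in> P - D \<union> insert v F" "y \<in> P - D \<union> insert v F" "{x, y} \<in> edges G"
      have "x \<in> P" "y \<in> P"
        using xy insert.prems assms(4) by auto
      then show "(c(v := t)) x \<noteq> (c(v := t)) y"
        using xy c t(2) simple_graph_no_loop[OF assms(1)] unfolding proper_def
        by (auto simp: insert_commute image_iff)
    qed
    then show ?case by blast
  qed
  from this[OF finD] obtain c where "proper c (P - D \<union> D)"
    by blast
  then have "proper c P"
    using assms(4) by (metis Un_Diff_cancel2 sup.absorb1)
  then have "colorable (induced G P) m"
    unfolding colorable_def proper_def by (auto simp: edges_induced)
  then show False using assms(3) by blast
qed

section \<open>Hubs\<close>

text \<open>\<open>D\<close> may be any set, even empty, and nothing is said about the edges inside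
  it. The form is self-dual: complementation exchanges \<open>K\<close> and
  \<open>S\<close>.\<close>

definition hub_partition :: "'a graph \<Rightarrow> 'a set \<Rightarrow> 'a set \<Rightarrow> 'a set \<Rightarrow> bool" where
  "hub_partition G D K S \<longleftrightarrow>
     simple_graph G \<and> verts G = D \<union> (K \<union> S) \<and> D \<inter> K = {} \<and> D \<inter> S = {} \<and> K \<inter> S = {} \<and>
     clique K (edges G) \<and> indep S (edges G) \<and>
     (\<forall>d\<in>D. \<forall>k\<in>K. {d, k} \<in> edges G) \<and> (\<forall>d\<in>D. \<forall>s\<in>S. {d, s} \<notin> edges G)"

lemma hub_partitionD:
  assumes "hub_partition G D K S"
  shows "simple_graph G" "verts G = D \<union> (K \<union> S)" "D \<inter> K = {}" "D \<inter> S = {}" "K \<inter> S = {}"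
    "clique K (edges G)" "indep S (edges G)"
    "\<And>d k. d \<in> D \<Longrightarrow> k \<in> K \<Longrightarrow> {d, k} \<in> edges G"
    "\<And>d k. d \<in> D \<Longrightarrow> k \<in> K \<Longrightarrow> {k, d} \<in> edges G"
    "\<And>d s. d \<in> D \<Longrightarrow> s \<in> S \<Longrightarrow> {d, s} \<notin> edges G"
    "\<And>d s. d \<in> D \<Longrightarrow> s \<in> S \<Longrightarrow> {s, d} \<notin> edges G"
    "finite D" "finite K" "finite S"
proof -
  have "{k, d} = {d, k}" for k d :: 'a
    by blast
  moreover have "finite (D \<union> (K \<union> S))"
    using assms finite_verts unfolding hub_partition_def by metis
  ultimately show "simple_graph G" "verts G = D \<union> (K \<union> S)"
    "D \<inter> K = {}" "D \<inter> S = {}" "K \<inter> S = {}"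
    "clique K (edges G)" "indep S (edges G)"
    "\<And>d k. d \<in> D \<Longrightarrow> k \<in> K \<Longrightarrow> {d, k} \<in> edges G"
    "\<And>d k. d \<in> D \<Longrightarrow> k \<in> K \<Longrightarrow> {k, d} \<in> edges G"
    "\<And>d s. d \<in> D \<Longrightarrow> s \<in> S \<Longrightarrow> {d, s} \<notin> edges G"
    "\<And>d s. d \<in> D \<Longrightarrow> s \<in> S \<Longrightarrow> {s, d} \<notin> edges G"
    "finite D" "finite K" "finite S"
    using assms unfolding hub_partition_def by simp_all
qed

lemma hub_partition_complement:
  assumes "hub_partition G D K S"
  shows "hub_partition (complement G) D S K"
proof -
  note h = hub_partitionD[OF assms]
  have "K \<subseteq> verts G" "S \<subseteq> verts G"
    using h(2) by auto
  then have "clique S (edges (complement G))" "indep K (edges (complement G))"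
    using h(6,7) by (simp_all add: clique_complement indep_complement)
  moreover have "\<forall>d\<in>D. \<forall>s\<in>S. {d, s} \<in> edges (complement G)"
    using h(2,4,10) by (auto simp: edges_complement)
  moreover have "\<forall>d\<in>D. \<forall>k\<in>K. {d, k} \<notin> edges (complement G)"
    using h(8) by (simp add: edges_complement)
  ultimately show ?thesis
    using h(2-5) simple_graph_complement[OF h(1)] unfolding hub_partition_def
    by (simp add: Un_commute Int_commute)
qed

lemma hub_partition_graph_iso:
  assumes "hub_partition G D K S" "graph_iso f G H" "simple_graph H"
  shows "hub_partition H (f ` D) (f ` K) (f ` S)"
proof -
  note h = hub_partitionD[OF assms(1)]
  have sub: "D \<subseteq> verts G" "K \<subseteq> verts G" "S \<subseteq> verts G"
    using h(2) by auto
  have disj: "f ` X \<inter> f ` Y = {}" if "X \<inter> Y = {}" "X \<subseteq> verts G" "Y \<subseteq> verts G" for X Y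
    using that inj_on_image_Int[OF graph_iso_inj[OF assms(2)] that(2,3)] by simp
  have edge: "{f u, f v} \<in> edges H \<longleftrightarrow> {u, v} \<in> edges G"
    if "u \<in> X" "v \<in> Y" "X \<subseteq> verts G" "Y \<subseteq> verts G" for u v X Y
    using that graph_iso_edge[OF assms(2)] by blast
  show ?thesis
    unfolding hub_partition_def
  proof (intro conjI)
    show "verts H = f ` D \<union> (f ` K \<union> f ` S)"
      using graph_iso_image[OF assms(2)] h(2) by (simp add: image_Un)
    show "clique (f ` K) (edges H)"
      using clique_graph_iso[OF assms(2) sub(2)] h(6) by simp
    show "indep (f ` S) (edges H)"
      using indep_graph_iso[OF assms(2) sub(3)] h(7) by simp
    show "\<forall>d\<in>f ` D. \<forall>k\<in>f ` K. {d, k} \<in> edges H"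
      using edge[OF _ _ sub(1,2)] h(8) by simp
    show "\<forall>d\<in>f ` D. \<forall>s\<in>f ` S. {d, s} \<notin> edges H"
      using edge[OF _ _ sub(1,3)] h(10) by simp
    show "f ` D \<inter> f ` K = {}" "f ` D \<inter> f ` S = {}" "f ` K \<inter> f ` S = {}"
      by (rule disj[OF h(3) sub(1,2)] disj[OF h(4) sub(1,3)] disj[OF h(5) sub(2,3)])+
  qed (fact assms(3))
qed

text \<open>All of \<open>D\<close> is joined to the clique \<open>K\<close>, so a colouring of
  \<open>G\<close> uses \<open>card K\<close> colours that never occur on \<open>D\<close>.
  Conversely, \<open>K\<close> gets the colours from \<open>j\<close> on and all of \<open>S\<close>
  repeats the colour of one vertex of \<open>D\<close>, which is why \<open>D\<close> must be
  nonempty.\<close>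

lemma colorable_hub_iff:
  assumes "hub_partition G D K S" "D \<noteq> {}"
  shows "colorable G (j + card K) \<longleftrightarrow> colorable (induced G D) j"
proof
  note h = hub_partitionD[OF assms(1)]
  assume "colorable G (j + card K)"
  then obtain c where c: "c ` verts G \<subseteq> {..<j + card K}"
    and proper: "\<And>u v. u \<in> verts G \<Longrightarrow> v \<in> verts G \<Longrightarrow> {u, v} \<in> edges G \<Longrightarrow> c u \<noteq> c v"
    by (rule colorableE) (rule that)
  have "inj_on c K"
  proof (rule inj_onI)
    fix x y assume "x \<in> K" "y \<in> K" "c x = c y"
    then show "x = y"
      using h(2,6) proper[of x y] unfolding clique_def by blast
  qed
  \<comment> \<open>Exactly \<open>j\<close> colours remain for \<open>D\<close>; \<open>g\<close>
    renames them to the numbers below \<open>j\<close>.\<close>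
  then have "card ({..<j + card K} - c ` K) = j"
    using c h(2,13) by (subst card_Diff_subset) (auto simp: card_image)
  then obtain g where g: "bij_betw g ({..<j + card K} - c ` K) {..<j}"
    using ex_bij_betw_finite_nat[of "{..<j + card K} - c ` K"] by (auto simp: lessThan_atLeast0)
  have cD: "c ` D \<subseteq> {..<j + card K} - c ` K"
  proof
    fix t assume "t \<in> c ` D"
    then obtain d where d: "d \<in> D" "t = c d" by blast
    have "c d \<noteq> c k" if "k \<in> K" for k
      using proper[of d k] h(2) h(8)[OF d(1) that] d(1) that by blast
    then show "t \<in> {..<j + card K} - c ` K"
      using c d h(2) by auto
  qed
  show "colorable (induced G D) j"
    unfolding colorable_def
  proof (intro exI conjI ballI impI)
    show "(g \<circ> c) ` verts (induced G D) \<subseteq> {..<j}"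
      using g cD unfolding bij_betw_def by (simp add: image_comp[symmetric]) blast
    fix u v assume uv: "u \<in> verts (induced G D)" "v \<in> verts (induced G D)"
      "{u, v} \<in> edges (induced G D)"
    then have "c u \<noteq> c v"
      using proper[of u v] h(2) by (auto simp: edges_induced)
    moreover have "c u \<in> {..<j + card K} - c ` K" "c v \<in> {..<j + card K} - c ` K"
      using uv cD by auto
    ultimately show "(g \<circ> c) u \<noteq> (g \<circ> c) v"
      using g unfolding bij_betw_def inj_on_def by auto
  qed
next
  note h = hub_partitionD[OF assms(1)]
  assume "colorable (induced G D) j"
  then obtain c where c: "c ` D \<subseteq> {..<j}"
    and proper: "\<And>u v. u \<in> D \<Longrightarrow> v \<in> D \<Longrightarrow> {u, v} \<in> edges G \<Longrightarrow> c u \<noteq> c v"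
    by (rule colorableE) (rule that, simp_all add: edges_induced)
  obtain d where d: "d \<in> D"
    using assms(2) by blast
  obtain g where g: "bij_betw g K {..<card K}"
    using ex_bij_betw_finite_nat[OF h(13)] by (auto simp: lessThan_atLeast0)
  have gK: "g k < card K" if "k \<in> K" for k
    using g that by (auto simp: bij_betw_def)
  have cD: "c x < j" if "x \<in> D" for x
    using c that by auto
  define b where "b x = (if x \<in> D then c x else if x \<in> K then j + g x else c d)" for x
  have vals: "b x = c x" "c x < j" if "x \<in> D" for x
    using that cD by (auto simp: b_def)
  have valK: "b x = j + g x" if "x \<in> K" for x
    using that h(3) by (auto simp: b_def)
  have valS: "b x = c d" "c d < j" if "x \<in> S" for x
    using that h(4,5) cD[OF d] by (auto simp: b_def)
  show "colorable G (j + card K)"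
    unfolding colorable_def
  proof (intro exI conjI ballI impI)
    show "b ` verts G \<subseteq> {..<j + card K}"
      using h(2) vals valK valS gK by fastforce
    fix u v assume uv: "u \<in> verts G" "v \<in> verts G" "{u, v} \<in> edges G"
    have ne: "u \<noteq> v"
      using simple_graph_edgeD(3)[OF h(1) uv(3)] .
    consider "u \<in> D" "v \<in> D" | "u \<in> K" "v \<in> K" | "u \<in> K" "v \<notin> K" | "u \<notin> K" "v \<in> K"
      | "u \<in> S" "v \<in> S" | "u \<in> D" "v \<in> S" | "u \<in> S" "v \<in> D"
      using uv(1,2) h(2) by blast
    then show "b u \<noteq> b v"
    proof cases
      case 1
      then show ?thesis using proper uv(3) vals by simp
    next
      case 2
      then show ?thesis
        using g ne by (auto simp: valK bij_betw_def inj_on_def)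
    next
      case 3
      then have "b v < j"
        using uv(2) h(2) vals valS by auto
      then show ?thesis using valK[OF 3(1)] by simp
    next
      case 4
      then have "b u < j"
        using uv(1) h(2) vals valS by auto
      then show ?thesis using valK[OF 4(2)] by simp
    next
      case 5
      then show ?thesis
        using h(7) uv(3) ne by (auto simp: indep_def)
    next
      case 6
      then show ?thesis using h(10) uv(3) by blast
    next
      case 7
      then show ?thesis using h(11) uv(3) by blast
    qed
  qed
qed

lemma chromatic_number_hub:
  assumes "hub_partition G D K S" "D \<noteq> {}"
  shows "chromatic_number G = chromatic_number (induced G D) + card K"
proof -
  note h = hub_partitionD[OF assms(1)]
  have sD: "simple_graph (induced G D)"
    using h(1,2) by (intro simple_graph_induced) auto
  have "chromatic_number G \<le> chromatic_number (induced G D) + card K"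
    using colorable_hub_iff[OF assms] colorable_iff_chromatic_number_le h(1) sD by blast
  moreover have "chromatic_number (induced G D) \<le> chromatic_number G - card K"
  proof -
    have "colorable G (chromatic_number G - card K + card K)"
      by (simp add: colorable_iff_chromatic_number_le[OF h(1)])
    then have "colorable (induced G D) (chromatic_number G - card K)"
      using colorable_hub_iff[OF assms] by blast
    then show ?thesis
      by (simp add: colorable_iff_chromatic_number_le[OF sD])
  qed
  \<comment> \<open>Subtraction on natural numbers truncates, so the previous bound can be added up
    only once \<open>K\<close> is known to need \<open>card K\<close> colours.\<close>
  moreover have "card K \<le> chromatic_number G"
  proof -
    have "colorable G (chromatic_number G)"
      by (simp add: colorable_iff_chromatic_number_le[OF h(1)])
    then obtain c where c: "c ` verts G \<subseteq> {..<chromatic_number G}"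
      and proper: "\<And>u v. u \<in> verts G \<Longrightarrow> v \<in> verts G \<Longrightarrow> {u, v} \<in> edges G \<Longrightarrow> c u \<noteq> c v"
      by (rule colorableE) (rule that)
    have "inj_on c K"
    proof (rule inj_onI)
      fix x y assume "x \<in> K" "y \<in> K" "c x = c y"
      then show "x = y"
        using h(2,6) proper[of x y] unfolding clique_def by blast
    qed
    then have "card K \<le> card {..<chromatic_number G}"
      using c h(2) by (intro card_inj_on_le) auto
    then show ?thesis by simp
  qed
  ultimately show ?thesis by linarith
qed

text \<open>\<open>K\<close> adds \<open>card K\<close> to the chromatic number of \<open>G\<close>,
  \<open>S\<close> adds \<open>card S\<close> to that of the complement, and the order grows by the
  same two amounts. So the NG equation is decided inside the hub.\<close>

lemma NG_graph_hub_iff: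
  assumes "hub_partition G D K S" "D \<noteq> {}"
  shows "NG_graph G \<longleftrightarrow> NG_graph (induced G D)"
proof -
  note h = hub_partitionD[OF assms(1)]
  have "complement (induced G D) = induced (complement G) D"
    using h(2) by (intro complement_induced) auto
  moreover have "card (verts G) = card D + (card K + card S)"
    using h(2-5,12-14) by (simp add: card_Un_disjoint Int_Un_distrib)
  ultimately show ?thesis
    using chromatic_number_hub[OF assms]
      chromatic_number_hub[OF hub_partition_complement[OF assms(1)] assms(2)]
    by (auto simp: NG_graph_def)
qed

lemma chromatic_number_single: "chromatic_number (induced G {a}) = 1" if "simple_graph G"
proof -
  have "colorable (induced G {a}) 1"
    using simple_graph_no_loop[OF that]
    unfolding colorable_def by (intro exI[of _ "\<lambda>_. 0"]) (auto simp: induced_def)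
  moreover have "\<not> colorable (induced G {a}) 0"
    unfolding colorable_def by auto
  ultimately show ?thesis
    unfolding chromatic_number_def by (metis LeastI Least_le le_neq_implies_less less_one)
qed

text \<open>A one-vertex graph and its complement both have chromatic number 1, so the hub itself is
  an NG-graph.\<close>

lemma NG_graph_hub_single:
  assumes "hub_partition G {a} K S"
  shows "NG_graph G" "chromatic_number G = card K + 1"
proof -
  note h = hub_partitionD[OF assms]
  have "complement (induced G {a}) = induced (complement G) {a}"
    using h(2) by (intro complement_induced) auto
  then have "NG_graph (induced G {a})"
    using chromatic_number_single[OF h(1)] chromatic_number_single[OF simple_graph_complement[OF h(1)]]
    by (simp add: NG_graph_def)
  then show "NG_graph G"
    using NG_graph_hub_iff[OF assms] by simp
  show "chromatic_number G = card K + 1"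
    using chromatic_number_hub[OF assms] chromatic_number_single[OF h(1)] by simp
qed

section \<open>Complementation and the ABC-partition\<close>

lemma deg_complement:
  assumes "simple_graph G" "v \<in> verts G"
  shows "deg (complement G) v + deg G v + 1 = card (verts G)"
proof -
  let ?N = "{u \<in> verts G. {u, v} \<in> edges G}"
    and ?M = "{u \<in> verts G. {u, v} \<in> edges (complement G)}"
  have fin: "finite (verts G)"
    using assms(1) by (rule finite_verts)
  have "verts G = insert v (?M \<union> ?N)"
    using assms(2) by (auto simp: edges_complement)
  moreover have "v \<notin> ?M \<union> ?N"
    using simple_graph_no_loop[OF assms(1)] by (auto simp: edges_complement)
  moreover have "?M \<inter> ?N = {}"
    by (auto simp: edges_complement)
  ultimately have "card (verts G) = Suc (card ?M + card ?N)"
    using fin by (metis (no_types, lifting) card_Un_disjoint card_insert_disjoint finite_Un finite_insert)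
  then show ?thesis
    by (simp add: deg_conv_neighbours assms(1) simple_graph_complement)
qed

lemma chromatic_number_pos:
  assumes "v \<in> verts G" "simple_graph G"
  shows "chromatic_number G > 0"
proof -
  have "\<not> colorable G 0"
    using assms(1) unfolding colorable_def by auto
  then show ?thesis
    using colorable_iff_chromatic_number_le[OF assms(2), of 0] by simp
qed

lemma NG_graph_complement:
  "simple_graph G \<Longrightarrow> NG_graph (complement G) \<longleftrightarrow> NG_graph G"
  by (simp add: NG_graph_def complement_complement add.commute)

text \<open>The degrees of a vertex in \<open>G\<close> and in the complement add up to one less
  than the order. For an NG-graph so do the two threshold degrees, hence one degree meets its
  threshold exactly when the other does.\<close>

lemma A_part_complement:
  assumes "simple_graph G" "NG_graph G"
  shows "A_part (complement G) = A_part G"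
proof -
  have "deg (complement G) v = chromatic_number (complement G) - 1 \<longleftrightarrow>
        deg G v = chromatic_number G - 1" if "v \<in> verts G" for v
    using deg_complement[OF assms(1) that] chromatic_number_pos[OF that assms(1)]
      chromatic_number_pos[of v "complement G"] that simple_graph_complement[OF assms(1)] assms(2)
    by (auto simp: NG_graph_def)
  then show ?thesis
    unfolding A_part_def by auto
qed

lemma NG1_graph_complement:
  assumes "simple_graph G"
  shows "NG1_graph (complement G) \<longleftrightarrow> NG2_graph G"
  using clique_complement[OF A_part_subset, of G] A_part_complement[OF assms]
    NG_graph_complement[OF assms]
  by (auto simp: NG1_graph_def NG2_graph_def)

lemma NG2_graph_complement:
  assumes "simple_graph G"
  shows "NG2_graph (complement G) \<longleftrightarrow> NG1_graph G"
  using NG1_graph_complement[OF simple_graph_complement[OF assms]] complement_complement[OF assms]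
  by simp

section \<open>One-vertex hubs: deciding membership in NG-1 and NG-2\<close>

lemma hub_in_A_part:
  assumes "hub_partition G {a} K S"
  shows "a \<in> A_part G"
proof -
  note h = hub_partitionD[OF assms]
  have "{u \<in> verts G. {u, a} \<in> edges G} = K"
    using h(2) h(9)[of a] h(11)[of a] simple_graph_no_loop[OF h(1)] by auto
  then show ?thesis
    using NG_graph_hub_single(2)[OF assms] h(2) by (simp add: A_part_def deg_conv_neighbours[OF h(1)])
qed

text \<open>The neighbours of \<open>s\<close> all lie in \<open>K\<close>, while the threshold
  degree is \<open>card K\<close>; reaching it means being joined to all of
  \<open>K\<close>.\<close>

lemma stable_side_in_A_part_iff:
  assumes "hub_partition G {a} K S" "s \<in> S"
  shows "s \<in> A_part G \<longleftrightarrow> (\<forall>k\<in>K. {k, s} \<in> edges G)"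
proof -
  note h = hub_partitionD[OF assms(1)]
  let ?N = "{k \<in> K. {k, s} \<in> edges G}"
  have "{u, s} \<notin> edges G" if "u \<in> S" for u
    using h(7) assms(2) that simple_graph_no_loop[OF h(1), of s]
    by (cases "u = s") (auto simp: indep_def)
  then have "{u \<in> verts G. {u, s} \<in> edges G} = ?N"
    using h(2) h(10)[OF _ assms(2)] by auto
  then have "s \<in> A_part G \<longleftrightarrow> card ?N = card K"
    using NG_graph_hub_single(2)[OF assms(1)] h(2) assms(2)
    by (simp add: A_part_def deg_conv_neighbours[OF h(1)])
  also have "\<dots> \<longleftrightarrow> ?N = K"
    using card_subset_eq[OF h(13), of ?N] by auto
  also have "\<dots> \<longleftrightarrow> (\<forall>k\<in>K. {k, s} \<in> edges G)"
    by auto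
  finally show ?thesis .
qed

text \<open>A vertex of \<open>S\<close> joined to all of \<open>K\<close> lies in the part A
  together with \<open>a\<close>, to which it is not adjacent. Without such a vertex the part A is
  contained in the clique \<open>insert a K\<close>.\<close>

lemma NG1_graph_hub_iff:
  assumes "hub_partition G {a} K S"
  shows "NG1_graph G \<longleftrightarrow> \<not> (\<exists>s\<in>S. \<forall>k\<in>K. {k, s} \<in> edges G)"
proof
  note h = hub_partitionD[OF assms]
  assume "NG1_graph G"
  then have cl: "clique (A_part G) (edges G)"
    by (simp add: NG1_graph_def)
  show "\<not> (\<exists>s\<in>S. \<forall>k\<in>K. {k, s} \<in> edges G)"
  proof
    assume "\<exists>s\<in>S. \<forall>k\<in>K. {k, s} \<in> edges G"
    then obtain s where s: "s \<in> S" "s \<in> A_part G"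
      using stable_side_in_A_part_iff[OF assms] by blast
    moreover have "a \<noteq> s"
      using s(1) h(4) by blast
    ultimately have "{a, s} \<in> edges G"
      using cl hub_in_A_part[OF assms] by (simp add: clique_def)
    then show False
      using h(10)[of a s] s(1) by simp
  qed
next
  note h = hub_partitionD[OF assms]
  assume "\<not> (\<exists>s\<in>S. \<forall>k\<in>K. {k, s} \<in> edges G)"
  then have "A_part G \<inter> S = {}"
    using stable_side_in_A_part_iff[OF assms] by blast
  then have "A_part G \<subseteq> insert a K"
    using A_part_subset[of G] h(2) by blast
  moreover have "clique (insert a K) (edges G)"
    using h(6) h(8)[of a] h(9)[of a] by (simp add: clique_def)
  ultimately show "NG1_graph G"
    using NG_graph_hub_single(1)[OF assms] smaller_clique by (simp add: NG1_graph_def)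
qed

text \<open>This is the criterion for \<open>NG1_graph\<close> read in the complement, where
  \<open>K\<close> and \<open>S\<close> change places.\<close>

lemma NG2_graph_hub_iff:
  assumes "hub_partition G {a} K S"
  shows "NG2_graph G \<longleftrightarrow> \<not> (\<exists>k\<in>K. \<forall>s\<in>S. {s, k} \<notin> edges G)"
proof -
  note h = hub_partitionD[OF assms]
  have "{s, k} \<in> edges (complement G) \<longleftrightarrow> {s, k} \<notin> edges G" if "s \<in> S" "k \<in> K" for s k
    using that h(2,5) by (auto simp: edges_complement)
  then show ?thesis
    using NG1_graph_hub_iff[OF hub_partition_complement[OF assms]]
    by (simp add: NG1_graph_complement[OF h(1)])
qed

text \<open>Failing both criteria would give an \<open>s\<close> joined to all of \<open>K\<close>
  and a \<open>k\<close> joined to nothing in \<open>S\<close>; these disagree about the pair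
  \<open>{s, k}\<close>.\<close>

lemma NG1_or_NG2_graph_hub:
  assumes "hub_partition G {a} K S"
  shows "NG1_graph G \<or> NG2_graph G"
proof -
  have "{s, k} = {k, s}" for s k :: 'a
    by blast
  then show ?thesis
    unfolding NG1_graph_hub_iff[OF assms] NG2_graph_hub_iff[OF assms] by metis
qed

section \<open>Balanced and unbalanced split graphs\<close>

lemma split_partitionD:
  assumes "simple_graph G" "split_partition G K S"
  shows "verts G = K \<union> S" "K \<inter> S = {}" "clique K (edges G)" "indep S (edges G)"
    "finite K" "finite S"
proof -
  have "K \<union> S = verts G"
    using assms(2) by (simp add: split_partition_def)
  moreover from this have "finite K" "finite S"
    using finite_verts[OF assms(1)] by (metis finite_Un)+
  ultimately show "verts G = K \<union> S" "K \<inter> S = {}" "clique K (edges G)" "indep S (edges G)"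
    "finite K" "finite S"
    using assms(2) by (simp_all add: split_partition_def)
qed

lemma split_partition_complement:
  assumes "split_partition G K S"
  shows "split_partition (complement G) S K"
proof -
  have "K \<subseteq> verts G" "S \<subseteq> verts G"
    using assms unfolding split_partition_def by auto
  then show ?thesis
    using assms
    by (simp add: split_partition_def clique_complement indep_complement Un_commute Int_commute)
qed

text \<open>A clique contains at most one vertex \<open>s\<close> of \<open>S\<close>. It beats
  \<open>K\<close> only if \<open>s\<close> is joined to all of \<open>K\<close>; otherwise taking
  \<open>s\<close> costs at least one vertex of \<open>K\<close>.\<close>

lemma clique_number_split:
  assumes "simple_graph G" "split_partition G K S"
  shows "clique_number G = (if \<exists>s\<in>S. \<forall>k\<in>K. {k, s} \<in> edges G then card K + 1 else card K)"
    (is "_ = ?m")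
  unfolding clique_number_def
proof (rule Max_eqI)
  note h = split_partitionD[OF assms]
  let ?F = "{card L | L. L \<subseteq> verts G \<and> clique L (edges G)}"
  have "?F \<subseteq> card ` Pow (verts G)"
    by blast
  then show "finite ?F"
    using finite_verts[OF assms(1)] finite_subset by blast
  show "?m \<in> ?F"
  proof (cases "\<exists>s\<in>S. \<forall>k\<in>K. {k, s} \<in> edges G")
    case True
    then obtain s where s: "s \<in> S" "\<And>k. k \<in> K \<Longrightarrow> {k, s} \<in> edges G"
      by blast
    have "clique (insert s K) (edges G)"
      using h(3) s(2) by (auto simp: clique_def insert_commute)
    moreover have "s \<notin> K"
      using s(1) h(2) by blast
    moreover have "insert s K \<subseteq> verts G"
      using s(1) h(1) by blast
    moreover have "card (insert s K) = card K + 1"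
      using h(5) \<open>s \<notin> K\<close> by simp
    ultimately show ?thesis
      using True by (auto intro: exI[of _ "insert s K"])
  next
    case False
    then show ?thesis
      using h(1,3) by auto
  qed
  fix y assume "y \<in> ?F"
  then obtain L where L: "L \<subseteq> K \<union> S" "clique L (edges G)" "y = card L"
    using h(1) by auto
  have "clique (L \<inter> S) (edges G)" "indep (L \<inter> S) (edges G)"
    using L(2) h(4) smaller_clique smaller_indep by blast+
  then consider "L \<inter> S = {}" | s where "L \<inter> S = {s}"
    using card_clique_indep_le_1[of "L \<inter> S" "edges G" "L \<inter> S"] by blast
  then show "y \<le> ?m"
  proof cases
    case 1
    then have "card L \<le> card K"
      using L(1) h(5) by (intro card_mono) auto
    then show ?thesis using L(3) by simp
  next
    case s: 2
    show ?thesis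
    proof (cases "\<forall>k\<in>K. {k, s} \<in> edges G")
      case True
      have "card L \<le> card (insert s K)"
        using L(1) h(5) s by (intro card_mono) auto
      also have "\<dots> \<le> card K + 1"
        using h(5) by (simp add: card_insert_if)
      finally show ?thesis
        using True s L(3) by auto
    next
      case False
      then obtain k where k: "k \<in> K" "{k, s} \<notin> edges G"
        by blast
      then have "k \<noteq> s"
        using s h(2) by blast
      then have "k \<notin> L"
        using k(2) L(2) s unfolding clique_def by blast
      then have "L \<subseteq> insert s (K - {k})"
        using L(1) s by blast
      then have "card L \<le> card (insert s (K - {k}))"
        using h(5) by (intro card_mono) auto
      also have "\<dots> \<le> Suc (card (K - {k}))"
        using h(5) by (simp add: card_insert_if)
      also have "\<dots> = card K"
        using card_Suc_Diff1[OF h(5) k(1)] .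
      finally show ?thesis
        using L(3) by simp
    qed
  qed
qed

lemma independence_number_split:
  assumes "simple_graph G" "split_partition G K S"
  shows "independence_number G = (if \<exists>k\<in>K. \<forall>s\<in>S. {s, k} \<notin> edges G then card S + 1 else card S)"
proof -
  have "{s, k} \<in> edges (complement G) \<longleftrightarrow> {s, k} \<notin> edges G" if "s \<in> S" "k \<in> K" for s k
    using that split_partitionD(1,2)[OF assms] by (auto simp: edges_complement)
  then show ?thesis
    using clique_number_split[OF simple_graph_complement[OF assms(1)]
        split_partition_complement[OF assms(2)]]
    by (simp add: clique_number_complement)
qed

text \<open>The two sides of any split partition add up to the order, so in a balanced graph the
  clique and independence numbers do too. This can be tested on any given partition: neither number
  may exceed the size of its side.\<close>

lemma balanced_split_iff:
  assumes "simple_graph G" "split_partition G K S"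
  shows "balanced_split G \<longleftrightarrow>
     \<not> (\<exists>s\<in>S. \<forall>k\<in>K. {k, s} \<in> edges G) \<and> \<not> (\<exists>k\<in>K. \<forall>s\<in>S. {s, k} \<notin> edges G)"
proof
  have card: "card (verts G) = card K' + card S'" if "split_partition G K' S'" for K' S'
    using split_partitionD[OF assms(1) that] by (simp add: card_Un_disjoint)
  assume "balanced_split G"
  then obtain K' S' where "split_partition G K' S'"
    "card K' = clique_number G" "card S' = independence_number G"
    unfolding balanced_split_def by blast
  then have "clique_number G + independence_number G = card K + card S"
    using card card[OF assms(2)] by metis
  then show "\<not> (\<exists>s\<in>S. \<forall>k\<in>K. {k, s} \<in> edges G) \<and> \<not> (\<exists>k\<in>K. \<forall>s\<in>S. {s, k} \<notin> edges G)"
    unfolding clique_number_split[OF assms] independence_number_split[OF assms]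
    by (simp split: if_splits)
next
  assume "\<not> (\<exists>s\<in>S. \<forall>k\<in>K. {k, s} \<in> edges G) \<and> \<not> (\<exists>k\<in>K. \<forall>s\<in>S. {s, k} \<notin> edges G)"
  then have "card K = clique_number G" "card S = independence_number G"
    unfolding clique_number_split[OF assms] independence_number_split[OF assms] by auto
  with assms(2) show "balanced_split G"
    unfolding balanced_split_def by blast
qed

lemma split_partition_hub:
  assumes "hub_partition G D K S"
  shows "split_partition (induced G (K \<union> S)) K S" "simple_graph (induced G (K \<union> S))"
proof -
  note h = hub_partitionD[OF assms]
  show "split_partition (induced G (K \<union> S)) K S"
    using h(5-7) by (auto simp: split_partition_def clique_def indep_def edges_induced)
  show "simple_graph (induced G (K \<union> S))"
    using h(1,2) by (intro simple_graph_induced) auto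
qed

text \<open>The obstruction to \<open>NG1_graph\<close>, a vertex of \<open>S\<close> joined to all
  of \<open>K\<close>, is also what lifts the clique number of the graph without \<open>a\<close>
  above \<open>card K\<close>.\<close>

lemma NG1_graph_hub_iff_clique_number:
  assumes "hub_partition G {a} K S"
  shows "NG1_graph G \<longleftrightarrow> card K = clique_number (induced G (K \<union> S))"
  using clique_number_split[OF split_partition_hub(2,1)[OF assms]]
  by (auto simp: NG1_graph_hub_iff[OF assms] edges_induced)

lemma NG1_NG2_graph_hub_iff_balanced:
  assumes "hub_partition G {a} K S"
  shows "NG1_graph G \<and> NG2_graph G \<longleftrightarrow> balanced_split (induced G (K \<union> S))"
  using balanced_split_iff[OF split_partition_hub(2,1)[OF assms]]
  by (auto simp: NG1_graph_hub_iff[OF assms] NG2_graph_hub_iff[OF assms] edges_induced)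

text \<open>By the balance criterion an unbalanced split graph has a vertex that could change sides,
  and such a vertex is a hub. Conversely, a hub vertex counted into the clique side has no neighbour
  in \<open>S\<close>, which breaks the balance.\<close>

lemma unbalanced_split_iff_hub:
  assumes "simple_graph G"
  shows "unbalanced_split G \<longleftrightarrow> (\<exists>a K S. hub_partition G {a} K S)"
proof
  assume "unbalanced_split G"
  then obtain K S where sp: "split_partition G K S" and nb: "\<not> balanced_split G"
    unfolding unbalanced_split_def split_graph_def by blast
  note h = split_partitionD[OF assms sp]
  consider s where "s \<in> S" "\<And>k. k \<in> K \<Longrightarrow> {k, s} \<in> edges G"
    | k where "k \<in> K" "\<And>s. s \<in> S \<Longrightarrow> {s, k} \<notin> edges G"
    using nb unfolding balanced_split_iff[OF assms sp] by blast
  then show "\<exists>a K S. hub_partition G {a} K S"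
  proof cases
    case (1 s)
    have "hub_partition G {s} K (S - {s})"
      unfolding hub_partition_def
    proof (intro conjI)
      show "indep (S - {s}) (edges G)"
        using h(4) smaller_indep by blast
      show "\<forall>d\<in>{s}. \<forall>k\<in>K. {d, k} \<in> edges G"
        using 1(2) by (simp add: insert_commute)
      show "\<forall>d\<in>{s}. \<forall>x\<in>S - {s}. {d, x} \<notin> edges G"
        using h(4) 1(1) by (auto simp: indep_def)
    qed (use assms h(1-3) 1(1) in auto)
    then show ?thesis by blast
  next
    case (2 k)
    have "hub_partition G {k} (K - {k}) S"
      unfolding hub_partition_def
    proof (intro conjI)
      show "clique (K - {k}) (edges G)"
        using h(3) smaller_clique by blast
      show "\<forall>d\<in>{k}. \<forall>x\<in>S. {d, x} \<notin> edges G"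
        using 2(2) by (simp add: insert_commute)
      show "\<forall>d\<in>{k}. \<forall>x\<in>K - {k}. {d, x} \<in> edges G"
        using h(3) 2(1) by (auto simp: clique_def)
    qed (use assms h(1,2,4) 2(1) in auto)
    then show ?thesis by blast
  qed
next
  assume "\<exists>a K S. hub_partition G {a} K S"
  then obtain a K S where hub: "hub_partition G {a} K S" by blast
  note h = hub_partitionD[OF hub]
  have "clique (insert a K) (edges G)"
    using h(6) h(8)[of a] h(9)[of a] by (simp add: clique_def)
  then have sp: "split_partition G (insert a K) S"
    using h(2,4,5,7) by (simp add: split_partition_def)
  have "\<not> balanced_split G"
    using h(11)[of a] unfolding balanced_split_iff[OF assms sp] by auto
  then show "unbalanced_split G"
    using sp unfolding unbalanced_split_def split_graph_def by blast
qed

section \<open>Shrinking a clique hub or a stable hub to one vertex\<close>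

lemma ex_single_hub_if_clique:
  assumes "hub_partition G D K S" "clique D (edges G)" "a \<in> D"
  shows "hub_partition G {a} (K \<union> (D - {a})) S"
proof -
  note h = hub_partitionD[OF assms(1)]
  have "clique (K \<union> (D - {a})) (edges G)"
    using h(6,8,9) assms(2) by (auto simp: clique_def)
  moreover have "{a, k} \<in> edges G" if "k \<in> K \<union> (D - {a})" for k
    using that h(8) assms(2,3) by (auto simp: clique_def)
  ultimately show ?thesis
    using h(1-5,7,10) assms(3) unfolding hub_partition_def by auto
qed

lemma ex_single_hub_if_indep:
  assumes "hub_partition G D K S" "indep D (edges G)" "a \<in> D"
  shows "hub_partition G {a} K (S \<union> (D - {a}))"
proof -
  note h = hub_partitionD[OF assms(1)]
  have "clique D (edges (complement G))"
    using assms(2) h(2) by (subst clique_complement) auto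
  from hub_partition_complement[OF ex_single_hub_if_clique
      [OF hub_partition_complement[OF assms(1)] this assms(3)]]
  show ?thesis
    by (simp add: complement_complement[OF h(1)])
qed

section \<open>The structure of NG-graphs\<close>

text \<open>With \<open>m\<close> and \<open>m'\<close> one below the two chromatic numbers, the
  order is \<open>m + m' + 1\<close>, while \<open>P\<close> has more than \<open>m\<close> and
  \<open>Q\<close> more than \<open>m'\<close> vertices; so they meet. The constant \<open>r\<close>
  records that the hub is regular, which later limits the hubs inside a 5-cycle.\<close>

lemma NG_graph_hub:
  assumes "simple_graph G" "NG_graph G"
  obtains D K S r where "hub_partition G D K S" "D \<noteq> {}" "D \<subseteq> A_part G"
    "\<And>v. v \<in> D \<Longrightarrow> card {u \<in> D. {u, v} \<in> edges G} = r"
proof -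
  let ?C = "complement G"
  have sC: "simple_graph ?C"
    using assms(1) by (rule simple_graph_complement)
  have fin: "finite (verts G)"
    using assms(1) by (rule finite_verts)
  have "verts G \<noteq> {}"
  proof
    assume "verts G = {}"
    then have "colorable G 0" "colorable ?C 0"
      by (auto simp: colorable_def)
    then show False
      using assms \<open>verts G = {}\<close> sC
      by (simp add: NG_graph_def colorable_iff_chromatic_number_le)
  qed
  then obtain x where "x \<in> verts G" by blast
  define m where "m = chromatic_number G - 1"
  define m' where "m' = chromatic_number ?C - 1"
  have m: "chromatic_number G = m + 1" "chromatic_number ?C = m' + 1"
    using chromatic_number_pos[OF \<open>x \<in> verts G\<close> assms(1)]
      chromatic_number_pos[of x ?C] \<open>x \<in> verts G\<close> sC by (simp_all add: m_def m'_def)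
  then have n: "card (verts G) = m + m' + 1"
    using assms(2) by (simp add: NG_graph_def)
  have "\<not> colorable G m"
    using m by (simp add: colorable_iff_chromatic_number_le[OF assms(1)])
  then obtain P where P: "P \<subseteq> verts G" "\<not> colorable (induced G P) m" "m < card P"
    "\<And>v. v \<in> P \<Longrightarrow> m \<le> card {u \<in> P. {u, v} \<in> edges G}"
    by (rule ex_minimal_uncolorable[OF assms(1)]) (rule that)
  have "\<not> colorable ?C m'"
    using m by (simp add: colorable_iff_chromatic_number_le[OF sC])
  then obtain Q where Q: "Q \<subseteq> verts ?C" "\<not> colorable (induced ?C Q) m'" "m' < card Q"
    "\<And>v. v \<in> Q \<Longrightarrow> m' \<le> card {u \<in> Q. {u, v} \<in> edges ?C}"
    by (rule ex_minimal_uncolorable[OF sC]) (rule that)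
  note Q = Q(1)[unfolded verts_complement] Q(2-4)
  have finP: "finite P" and finQ: "finite Q"
    using P(1) Q(1) fin finite_subset by blast+
  define D where "D = P \<inter> Q"
  have "card (P \<union> Q) \<le> m + m' + 1"
    using P(1) Q(1) fin n by (metis Un_least card_mono)
  then have "D \<noteq> {}"
    using card_Un_Int[OF finP finQ] P(3) Q(3) unfolding D_def by auto
  \<comment> \<open>The neighbours in \<open>P\<close> and the non-neighbours in \<open>Q\<close>
    are disjoint and avoid \<open>v\<close>, so at most \<open>m + m'\<close> vertices are
    available. The lower bounds \<open>m\<close> and \<open>m'\<close> must then be attained, and
    nothing is left over.\<close>
  have nbrs: "verts G - {v} = {u \<in> P. {u, v} \<in> edges G} \<union> {u \<in> Q. {u, v} \<in> edges ?C} \<and>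
      card {u \<in> P. {u, v} \<in> edges G} = m \<and> card {u \<in> Q. {u, v} \<in> edges ?C} = m'"
    if v: "v \<in> D" for v
  proof -
    let ?N = "{u \<in> P. {u, v} \<in> edges G}" and ?M = "{u \<in> Q. {u, v} \<in> edges ?C}"
    have sub: "?N \<union> ?M \<subseteq> verts G - {v}"
      using P(1) Q(1) simple_graph_no_loop[OF assms(1)] by (auto simp: edges_complement)
    have "card (verts G - {v}) = m + m'"
      using v P(1) n fin by (auto simp: D_def)
    moreover have "card (?N \<union> ?M) = card ?N + card ?M"
      using finP finQ by (intro card_Un_disjoint) (auto simp: edges_complement)
    moreover have "card (?N \<union> ?M) \<le> card (verts G - {v})"
      using sub fin by (intro card_mono) auto
    moreover have "m \<le> card ?N" "m' \<le> card ?M"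
      using P(4) Q(4) v by (simp_all add: D_def)
    ultimately have "card ?N = m" "card ?M = m'" "card (?N \<union> ?M) = card (verts G - {v})"
      by linarith+
    moreover from this have "?N \<union> ?M = verts G - {v}"
      using sub fin by (intro card_subset_eq) auto
    ultimately show ?thesis by simp
  qed
  \<comment> \<open>Since the two sets exhaust the vertices other than \<open>v\<close>, a neighbour
    of \<open>v\<close> must come from \<open>P\<close> and, below, a non-neighbour from
    \<open>Q\<close>.\<close>
  have edge_P: "u \<in> P" if "v \<in> D" "u \<in> verts G" "{u, v} \<in> edges G" for u v
  proof -
    have "u \<in> {u \<in> P. {u, v} \<in> edges G} \<union> {u \<in> Q. {u, v} \<in> edges ?C}"
      using nbrs[OF that(1)] that simple_graph_edgeD(3)[OF assms(1) that(3)] by blast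
    then show ?thesis
      using that(3) by (auto simp: edges_complement)
  qed
  have nonedge_Q: "u \<in> Q" if "v \<in> D" "u \<in> verts G" "{u, v} \<notin> edges G" for u v
  proof (cases "u = v")
    case False
    then have "u \<in> {u \<in> P. {u, v} \<in> edges G} \<union> {u \<in> Q. {u, v} \<in> edges ?C}"
      using nbrs[OF that(1)] that by blast
    then show ?thesis
      using that(3) by simp
  qed (use that(1) D_def in simp)
  have join: "{u, v} \<in> edges G" if "u \<in> P - D" "v \<in> D" for u v
    using nonedge_Q[OF that(2), of u] that P(1) by (auto simp: D_def)
  have nonjoin: "{u, v} \<notin> edges G" if "u \<in> Q - D" "v \<in> D" for u v
    using edge_P[OF that(2), of u] that Q(1) by (auto simp: D_def)
  \<comment> \<open>The exact count of \<open>m\<close> neighbours in \<open>P\<close> supplies the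
    upper degree bound that the greedy colouring argument needs.\<close>
  have "clique (P - D) (edges G)"
    by (rule clique_outside_low_degree[OF assms(1) P(1,2)])
      (use nbrs join \<open>D \<noteq> {}\<close> in \<open>auto simp: D_def\<close>)
  moreover have "clique (Q - D) (edges ?C)"
  proof (rule clique_outside_low_degree[OF sC _ Q(2)])
    show "{u, v} \<in> edges ?C" if "u \<in> Q - D" "v \<in> D" for u v
      using nonjoin[OF that] that Q(1) P(1) by (auto simp: edges_complement D_def)
  qed (use nbrs Q(1) \<open>D \<noteq> {}\<close> in \<open>auto simp: D_def\<close>)
  then have "indep (Q - D) (edges G)"
    using clique_complement[of "Q - D" G] Q(1) by blast
  moreover have "verts G = D \<union> ((P - D) \<union> (Q - D))"
  proof
    obtain v where v: "v \<in> D"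
      using \<open>D \<noteq> {}\<close> by blast
    show "verts G \<subseteq> D \<union> ((P - D) \<union> (Q - D))"
      using edge_P[OF v] nonedge_Q[OF v] by blast
  qed (use P(1) Q(1) in \<open>auto simp: D_def\<close>)
  moreover have "\<forall>d\<in>D. \<forall>k\<in>P - D. {d, k} \<in> edges G" "\<forall>d\<in>D. \<forall>s\<in>Q - D. {d, s} \<notin> edges G"
    using join nonjoin by (metis insert_commute)+
  ultimately have hub: "hub_partition G D (P - D) (Q - D)"
    using assms(1) unfolding hub_partition_def D_def by blast
  have deg: "deg G v = m" if "v \<in> D" for v
  proof -
    have "{u \<in> verts G. {u, v} \<in> edges G} = {u \<in> P. {u, v} \<in> edges G}"
      using edge_P[OF that] P(1) by blast
    then show ?thesis
      using nbrs[OF that] by (simp add: deg_conv_neighbours[OF assms(1)])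
  qed
  have "D \<subseteq> A_part G"
    using deg P(1) m(1) by (auto simp: A_part_def D_def)
  \<comment> \<open>All of \<open>P - D\<close> is joined to \<open>v\<close>, so what remains of
    its \<open>m\<close> neighbours does not depend on \<open>v\<close>.\<close>
  moreover have "card {u \<in> D. {u, v} \<in> edges G} = m - card (P - D)" if "v \<in> D" for v
  proof -
    have "{u \<in> P. {u, v} \<in> edges G} = (P - D) \<union> {u \<in> D. {u, v} \<in> edges G}"
      using join[OF _ that] by (auto simp: D_def)
    moreover have "card \<dots> = card (P - D) + card {u \<in> D. {u, v} \<in> edges G}"
      using finP by (intro card_Un_disjoint) (auto simp: D_def)
    ultimately have "m = card (P - D) + card {u \<in> D. {u, v} \<in> edges G}"
      using nbrs[OF that] by metis
    then show ?thesis by simp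
  qed
  ultimately show thesis
    using that hub \<open>D \<noteq> {}\<close> by blast
qed

text \<open>The hub lies in the part A, so it inherits being a clique or stable and shrinks to one
  vertex. Graphs with a one-vertex hub are the unbalanced split graphs.\<close>

lemma NG1_or_NG2_graph_iff_unbalanced_split:
  assumes "simple_graph G"
  shows "NG1_graph G \<or> NG2_graph G \<longleftrightarrow> unbalanced_split G"
proof
  assume asm: "NG1_graph G \<or> NG2_graph G"
  then have "NG_graph G"
    by (auto simp: NG1_graph_def NG2_graph_def)
  from NG_graph_hub[OF assms this] obtain D K S where
    D: "hub_partition G D K S" "D \<noteq> {}" "D \<subseteq> A_part G"
    by metis
  then obtain a where a: "a \<in> D" by blast
  have "clique D (edges G) \<or> indep D (edges G)"
    using asm D(3) smaller_clique smaller_indep unfolding NG1_graph_def NG2_graph_def by metis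
  then show "unbalanced_split G"
    using ex_single_hub_if_clique[OF D(1) _ a] ex_single_hub_if_indep[OF D(1) _ a]
    unfolding unbalanced_split_iff_hub[OF assms] by blast
next
  assume "unbalanced_split G"
  then obtain a K S where "hub_partition G {a} K S"
    unfolding unbalanced_split_iff_hub[OF assms] by blast
  then show "NG1_graph G \<or> NG2_graph G"
    by (rule NG1_or_NG2_graph_hub)
qed

section \<open>Gluing along hubs\<close>

lemma hub_single_neighbours:
  assumes "hub_partition G {a} K S"
  shows "{u \<in> verts G. {u, a} \<in> edges G} = K"
proof -
  note h = hub_partitionD[OF assms]
  show ?thesis
    using h(2) h(9)[of a] h(11)[of a] simple_graph_no_loop[OF h(1)] by auto
qed

text \<open>\<open>K\<close> and \<open>K'\<close> have the same size, one less than the chromatic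
  number, so an inclusion of neighbourhoods suffices. If \<open>a\<close> and \<open>b\<close> are
  adjacent, \<open>b\<close> lies in the clique \<open>K\<close> and sees the rest of it; if they
  are distinct and non-adjacent, \<open>b\<close> lies in \<open>S\<close> and its neighbours are
  confined to \<open>K\<close>.\<close>

lemma hub_single_twins:
  assumes "hub_partition G {a} K S" "hub_partition G {b} K' S'" "w \<in> verts G - {a, b}"
  shows "{w, a} \<in> edges G \<longleftrightarrow> {w, b} \<in> edges G"
proof -
  note h = hub_partitionD[OF assms(1)] and h' = hub_partitionD[OF assms(2)]
  note N = hub_single_neighbours[OF assms(1)] and N' = hub_single_neighbours[OF assms(2)]
  have card: "card K = card K'"
    using NG_graph_hub_single(2)[OF assms(1)] NG_graph_hub_single(2)[OF assms(2)] by simp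
  have iff: "{v, a} \<in> edges G \<longleftrightarrow> v \<in> K" "{v, b} \<in> edges G \<longleftrightarrow> v \<in> K'" if "v \<in> verts G" for v
    using that N N' by blast+
  have ab: "a \<in> verts G" "b \<in> verts G"
    using h(2) h'(2) by auto
  have sym: "b \<in> K \<longleftrightarrow> a \<in> K'"
    using iff(1)[OF ab(2)] iff(2)[OF ab(1)] by (simp add: insert_commute)
  have "w \<in> K \<longleftrightarrow> w \<in> K'"
  proof (cases "a \<in> K'")
    case True
    have "K - {b} \<subseteq> K' - {a}"
    proof
      fix v assume v: "v \<in> K - {b}"
      then have "{v, b} \<in> edges G"
        using h(6) True sym by (simp add: clique_def)
      then show "v \<in> K' - {a}"
        using v iff(2)[of v] h(2,3) by auto
    qed
    moreover have "card (K - {b}) = card (K' - {a})"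
      using card True sym h(13) h'(13) by simp
    ultimately have "K - {b} = K' - {a}"
      using h'(13) by (intro card_subset_eq) auto
    then show ?thesis
      using assms(3) by blast
  next
    case False
    have "K' \<subseteq> K"
    proof (cases "a = b")
      case True
      then show ?thesis using N N' by simp
    next
      case ne: False
      show ?thesis
      proof
        fix v assume v: "v \<in> K'"
        then have "{v, b} \<in> edges G" "v \<in> verts G" "v \<noteq> a" "v \<noteq> b"
          using h'(2,3,9) False by auto
        moreover have "b \<in> S"
          using ab(2) h(2) ne False sym by auto
        then have "v \<notin> S"
          using h(7) \<open>{v, b} \<in> edges G\<close> \<open>v \<noteq> b\<close> by (auto simp: indep_def)
        ultimately show "v \<in> K"
          using h(2) by blast
      qed
    qed
    then have "K' = K"
      using h(13) card by (intro card_subset_eq) auto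
    then show ?thesis by simp
  qed
  then show ?thesis
    using iff assms(3) by simp
qed

text \<open>An arbitrary isomorphism may send \<open>a\<close> to another possible hub vertex of
  \<open>H\<close>. That vertex and \<open>b\<close> are twins, so swapping them repairs the map;
  \<open>K\<close> then follows as the neighbourhood of the hub and \<open>S\<close> as the
  rest.\<close>

lemma isomorphic_hub_singleE:
  assumes "hub_partition G {a} K S" "hub_partition H {b} K' S'" "isomorphic G H"
  obtains f where "graph_iso f G H" "f a = b" "f ` K = K'" "f ` S = S'"
proof -
  note h = hub_partitionD[OF assms(1)] and h' = hub_partitionD[OF assms(2)]
  obtain g where g: "graph_iso g G H"
    using assms(3) by (rule isomorphicE)
  have "hub_partition H {g a} (g ` K) (g ` S)"
    using hub_partition_graph_iso[OF assms(1) g h'(1)] by simp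
  moreover have "g a \<in> verts H"
    using graph_iso_image[OF g] h(2) by auto
  ultimately have t: "graph_iso (transpose (g a) b) H H"
    using hub_single_twins[OF _ assms(2)] h'(1,2) by (intro graph_iso_transpose) auto
  define f where "f = transpose (g a) b \<circ> g"
  have f: "graph_iso f G H"
    unfolding f_def using graph_iso_comp[OF g t] .
  have fa: "f a = b"
    by (simp add: f_def)
  have hub: "hub_partition H {b} (f ` K) (f ` S)"
    using hub_partition_graph_iso[OF assms(1) f h'(1)] fa by simp
  then have K: "f ` K = K'"
    using hub_single_neighbours[OF assms(2)] hub_single_neighbours[OF hub] by simp
  have "f ` S = verts H - ({b} \<union> K')" "S' = verts H - ({b} \<union> K')"
    using hub_partitionD(2,4,5)[OF hub] h'(2,4,5) K by auto
  then have "f ` S = S'" by simp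
  with f fa K show thesis by (rule that)
qed

text \<open>All edges between hub and outer part are dictated by the partition, so an isomorphism of
  the hubs combines with any isomorphism of the outer parts that respects the two sides.\<close>

lemma isomorphic_hub_glue:
  assumes "hub_partition G D K S" "hub_partition H D' K' S'"
    and p: "isomorphic (induced G D) (induced H D')"
    and q: "graph_iso q (induced G (K \<union> S)) (induced H (K' \<union> S'))" "q ` K = K'" "q ` S = S'"
  shows "isomorphic G H"
proof -
  note h = hub_partitionD[OF assms(1)] and h' = hub_partitionD[OF assms(2)]
  obtain p where p: "graph_iso p (induced G D) (induced H D')"
    using p by (rule isomorphicE)
  define f where "f x = (if x \<in> D then p x else q x)" for x
  have fD: "f x = p x" "p x \<in> D'" if "x \<in> D" for x
    using that graph_iso_image[OF p] by (auto simp: f_def)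
  have fK: "f x = q x" "q x \<in> K'" if "x \<in> K" for x
    using that q(2) h(3) by (auto simp: f_def)
  have fS: "f x = q x" "q x \<in> S'" if "x \<in> S" for x
    using that q(3) h(4) by (auto simp: f_def)
  have bp: "bij_betw f D D'"
    using p fD(1) bij_betw_cong[of D f p] by (simp add: graph_iso_def)
  have fKS: "f x = q x" if "x \<in> K \<union> S" for x
    using that fK(1) fS(1) by blast
  then have bq: "bij_betw f (K \<union> S) (K' \<union> S')"
    using q(1) bij_betw_cong[of "K \<union> S" f q] by (simp add: graph_iso_def)
  have "bij_betw f (verts G) (verts H)"
    unfolding h(2) h'(2) using h'(3,4) by (intro bij_betw_combine bp bq) auto
  moreover have "{u, v} \<in> edges G \<longleftrightarrow> {f u, f v} \<in> edges H"
    if uv: "u \<in> verts G" "v \<in> verts G" for u v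
  proof -
    consider "u \<in> D" "v \<in> D" | "u \<in> D" "v \<in> K" | "u \<in> D" "v \<in> S" | "u \<in> K" "v \<in> D"
      | "u \<in> S" "v \<in> D" | "u \<in> K \<union> S" "v \<in> K \<union> S"
      using uv h(2) by blast
    then show ?thesis
    proof cases
      case 1
      then show ?thesis
        using graph_iso_edge[OF p, of u v] fD by (simp add: edges_induced)
    next
      case 2
      then show ?thesis
        using fD fK h(8) h'(8) by simp
    next
      case 3
      then show ?thesis
        using fD fS h(10) h'(10) by simp
    next
      case 4
      then show ?thesis
        using fD fK h(9) h'(9) by simp
    next
      case 5
      then show ?thesis
        using fD fS h(11) h'(11) by simp
    next
      case 6
      moreover from this have "f u = q u" "f v = q v" "q u \<in> K' \<union> S'" "q v \<in> K' \<union> S'"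
        using fK fS by blast+
      ultimately show ?thesis
        using graph_iso_edge[OF q(1), of u v] by (simp add: edges_induced)
    qed
  qed
  ultimately show ?thesis
    unfolding isomorphic_def by blast
qed

text \<open>This reverses the removal or contraction of a hub: a copy of \<open>M\<close> is joined
  to all of \<open>K\<close>. The shift by \<open>N\<close> moves the copy past the vertices of
  \<open>H\<close>, so the outer part is \<open>H\<close> itself and not merely isomorphic to
  it.\<close>

lemma ex_hub_partition:
  fixes H :: "nat graph" and M :: "nat graph"
  assumes "simple_graph H" "split_partition H K S" "simple_graph M"
  obtains G :: "nat graph" and D where "hub_partition G D K S" "induced G (K \<union> S) = H"
    "isomorphic (induced G D) M" "card D = card (verts M)"
proof -
  note h = split_partitionD[OF assms(1,2)]
  obtain N where N: "\<And>x. x \<in> verts H \<Longrightarrow> x < N"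
    using finite_verts[OF assms(1)] finite_nat_set_iff_bounded by metis
  define p where "p i = N + i" for i
  define D where "D = p ` verts M"
  define G where "G = (D \<union> (K \<union> S),
    edges H \<union> (`) p ` edges M \<union> {{d, k} | d k. d \<in> D \<and> k \<in> K})"
  have inj: "inj p"
    by (simp add: inj_def p_def)
  have disj: "D \<inter> (K \<union> S) = {}"
    using N h(1) by (fastforce simp: D_def p_def)
  have H: "e \<subseteq> K \<union> S" "e \<noteq> {}" "card e = 2" if "e \<in> edges H" for e
    using that assms(1) h(1) by (auto simp: simple_graph_def nsets_def)
  have M: "e \<subseteq> D" "e \<noteq> {}" "card e = 2" if "e \<in> (`) p ` edges M" for e
  proof -
    from that obtain e' where e': "e' \<in> edges M" "e = p ` e'"
      by blast
    then have "e' \<subseteq> verts M" "card e' = 2"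
      using assms(3) by (auto simp: simple_graph_def nsets_def)
    then show "e \<subseteq> D" "card e = 2" "e \<noteq> {}"
      using e'(2) card_image[OF inj_on_subset[OF inj subset_UNIV], of e'] by (auto simp: D_def)
  qed
  have finD: "finite D"
    using finite_verts[OF assms(3)] by (simp add: D_def)
  have "e \<in> [verts G]\<^bsup>2\<^esup>" if "e \<in> edges G" for e
  proof -
    from that have "e \<in> edges H \<or> e \<in> (`) p ` edges M \<or> e \<in> {{d, k} | d k. d \<in> D \<and> k \<in> K}"
      by (auto simp: G_def)
    then have "e \<subseteq> D \<union> (K \<union> S) \<and> card e = 2"
    proof (elim disjE)
      assume "e \<in> edges H"
      then show ?thesis using H(1,3)[of e] by auto
    next
      assume "e \<in> (`) p ` edges M"
      then show ?thesis using M(1,3)[of e] by auto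
    next
      assume "e \<in> {{d, k} | d k. d \<in> D \<and> k \<in> K}"
      then obtain d k where "e = {d, k}" "d \<in> D" "k \<in> K" by blast
      moreover from this have "d \<noteq> k" using disj by blast
      ultimately show ?thesis by auto
    qed
    then show ?thesis
      using finD h(5,6) by (auto simp: G_def nsets_def intro: finite_subset)
  qed
  moreover have "finite (verts G)"
    using finD h(5,6) by (simp add: G_def)
  ultimately have sG: "simple_graph G"
    unfolding simple_graph_def by blast
  have edgeH: "e \<in> edges G \<longleftrightarrow> e \<in> edges H" if "e \<subseteq> K \<union> S" for e
  proof
    assume "e \<in> edges G"
    then consider "e \<in> edges H" | "e \<in> (`) p ` edges M" | d k where "e = {d, k}" "d \<in> D" "k \<in> K"
      unfolding G_def by auto
    then show "e \<in> edges H"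
    proof cases
      case 2
      have "e \<subseteq> D \<inter> (K \<union> S)"
        using M(1)[OF 2] that by (rule Int_greatest)
      then show ?thesis using M(2)[OF 2] disj by simp
    next
      case 3
      then have "d \<in> D \<inter> (K \<union> S)"
        using that by simp
      then show ?thesis using disj by simp
    qed
  qed (simp add: G_def)
  have edgeM: "{p i, p j} \<in> edges G \<longleftrightarrow> {i, j} \<in> edges M" if "i \<in> verts M" "j \<in> verts M" for i j
  proof -
    have ij: "{p i, p j} \<subseteq> D"
      using that by (simp add: D_def)
    have "{p i, p j} \<notin> edges H"
    proof
      assume "{p i, p j} \<in> edges H"
      then have "p i \<in> D \<inter> (K \<union> S)"
        using H(1)[of "{p i, p j}"] ij by auto
      then show False using disj by simp
    qed
    moreover have "{p i, p j} \<notin> {{d, k} | d k. d \<in> D \<and> k \<in> K}"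
    proof
      assume "{p i, p j} \<in> {{d, k} | d k. d \<in> D \<and> k \<in> K}"
      then obtain d k where "{p i, p j} = {d, k}" "k \<in> K" by blast
      then have "k \<in> D \<inter> (K \<union> S)"
        using ij by simp
      then show False using disj by simp
    qed
    moreover have "{p i, p j} \<in> (`) p ` edges M \<longleftrightarrow> {i, j} \<in> edges M"
    proof -
      have "{p i, p j} = p ` {i, j}" by simp
      then show ?thesis
        using inj_image_eq_iff[OF inj] by (metis (no_types, lifting) imageE imageI)
    qed
    ultimately show ?thesis
      by (simp only: G_def snd_conv Un_iff) blast
  qed
  show thesis
  proof (rule that)
    have "{d, s} \<notin> edges G" if "d \<in> D" "s \<in> S" for d s
    proof
      assume "{d, s} \<in> edges G"
      then consider "{d, s} \<in> edges H" | "{d, s} \<in> (`) p ` edges M"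
        | d' k where "{d, s} = {d', k}" "d' \<in> D" "k \<in> K"
        unfolding G_def by auto
      then show False
      proof cases
        case 1
        then have "d \<in> D \<inter> (K \<union> S)"
          using H(1)[of "{d, s}"] that(1) by simp
        then show ?thesis using disj by simp
      next
        case 2
        then have "s \<in> D \<inter> (K \<union> S)"
          using M(1)[of "{d, s}"] that(2) by auto
        then show ?thesis using disj by simp
      next
        case 3
        then have "k \<in> D \<inter> (K \<union> S) \<or> k \<in> K \<inter> S"
          using that by (auto simp: doubleton_eq_iff)
        then show ?thesis using disj h(2) by simp
      qed
    qed
    moreover have "clique K (edges G)"
      using h(3) by (auto simp: clique_def G_def)
    moreover have "indep S (edges G)"
      using h(4) edgeH by (simp add: indep_def)
    moreover have "{d, k} \<in> edges G" if "d \<in> D" "k \<in> K" for d k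
      using that by (auto simp: G_def)
    moreover have "verts G = D \<union> (K \<union> S)"
      by (simp add: G_def)
    moreover have "D \<inter> K = {}" "D \<inter> S = {}"
      using disj by auto
    ultimately show "hub_partition G D K S"
      using sG h(2) unfolding hub_partition_def by simp
    have "{e \<in> edges G. e \<subseteq> K \<union> S} = edges H"
      using edgeH H(1) by blast
    then show "induced G (K \<union> S) = H"
      using h(1) by (simp add: induced_def prod_eq_iff)
    have "graph_iso p M (induced G D)"
      unfolding graph_iso_def using inj_on_subset[OF inj subset_UNIV] edgeM
      by (auto simp: bij_betw_def D_def edges_induced)
    then show "isomorphic (induced G D) M"
      using isomorphicI isomorphic_sym by blast
    show "card D = card (verts M)"
      unfolding D_def by (rule card_image) (use inj in \<open>rule inj_on_subset\<close>, simp)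
  qed
qed

section \<open>Counting isomorphism classes\<close>

text \<open>One implication suffices, because isomorphism is symmetric.\<close>

definition iso_invariant :: "('a graph \<Rightarrow> bool) \<Rightarrow> bool" where
  "iso_invariant P \<longleftrightarrow>
     (\<forall>G H. simple_graph G \<longrightarrow> simple_graph H \<longrightarrow> isomorphic G H \<longrightarrow> P G \<longrightarrow> P H)"

lemma iso_invariantD:
  "iso_invariant P \<Longrightarrow> simple_graph G \<Longrightarrow> simple_graph H \<Longrightarrow> isomorphic G H \<Longrightarrow> P G \<longleftrightarrow> P H"
  unfolding iso_invariant_def using isomorphic_sym by blast

lemma iso_class_eq_iff:
  assumes "simple_graph G" "simple_graph H"
  shows "iso_rel `` {G} = iso_rel `` {H} \<longleftrightarrow> isomorphic G H"
  using eq_equiv_class_iff[OF equiv_iso_rel, of G H] assms by (simp add: iso_rel_def)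

lemma unlabeled_conv_image: "unlabeled P = (\<lambda>G. iso_rel `` {G}) ` {G. simple_graph G \<and> P G}"
  by (auto simp: unlabeled_def quotient_def)

text \<open>For an invariant property any representative of a class may be tested. This turns
  intersections and differences of sets of classes into conditions on graphs.\<close>

lemma iso_class_in_unlabeled_iff:
  assumes "iso_invariant P" "simple_graph G"
  shows "iso_rel `` {G} \<in> unlabeled P \<longleftrightarrow> P G"
  using iso_invariantD[OF assms(1)] iso_class_eq_iff assms(2)
  unfolding unlabeled_conv_image by blast

lemma unlabeled_inter:
  assumes "iso_invariant P" "iso_invariant Q"
  shows "unlabeled P \<inter> unlabeled Q = unlabeled (\<lambda>G. P G \<and> Q G)"
  using iso_class_in_unlabeled_iff[OF assms(2)] unfolding unlabeled_conv_image[of P]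
    unlabeled_conv_image[of "\<lambda>G. P G \<and> Q G"] by blast

lemma unlabeled_diff:
  assumes "iso_invariant P" "iso_invariant Q"
  shows "unlabeled P - unlabeled Q = unlabeled (\<lambda>G. P G \<and> \<not> Q G)"
  using iso_class_in_unlabeled_iff[OF assms(2)] unfolding unlabeled_conv_image[of P]
    unlabeled_conv_image[of "\<lambda>G. P G \<and> \<not> Q G"] by blast

lemma unlabeled_union: "unlabeled P \<union> unlabeled Q = unlabeled (\<lambda>G. P G \<or> Q G)"
  unfolding unlabeled_conv_image by blast

text \<open>The order is constant on an isomorphism class, so the existential over representatives
  in \<open>of_order\<close> can be evaluated at any one of them.\<close>

lemma of_order_unlabeled:
  "of_order (unlabeled P) k = unlabeled (\<lambda>G. P G \<and> int (card (verts G)) = k)"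
proof -
  have "(\<exists>H\<in>iso_rel `` {G}. int (card (verts H)) = k) \<longleftrightarrow> int (card (verts G)) = k"
    if "simple_graph G" for G
  proof
    assume "\<exists>H\<in>iso_rel `` {G}. int (card (verts H)) = k"
    then obtain H where "H \<in> iso_rel `` {G}" "int (card (verts H)) = k"
      by blast
    then show "int (card (verts G)) = k"
      using isomorphic_card[of G H] by (simp add: iso_rel_def)
  next
    have "G \<in> iso_rel `` {G}"
      using that isomorphic_refl by (simp add: iso_rel_def)
    then show "\<exists>H\<in>iso_rel `` {G}. int (card (verts H)) = k" if "int (card (verts G)) = k"
      using that by blast
  qed
  then show ?thesis
    unfolding of_order_def unlabeled_conv_image by blast
qed

text \<open>Two functions that identify the same pairs of arguments have equipollent images, through
  the map taking \<open>f x\<close> to \<open>g x\<close>.\<close>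

lemma image_eqpoll_image:
  assumes "\<And>x y. x \<in> A \<Longrightarrow> y \<in> A \<Longrightarrow> f x = f y \<longleftrightarrow> g x = g y"
  shows "f ` A \<approx> g ` A"
proof -
  define h where "h y = g (inv_into A f y)" for y
  have h: "h (f x) = g x" if "x \<in> A" for x
    using that assms f_inv_into_f[of "f x" f A] inv_into_into[of "f x" f A]
    by (simp add: h_def)
  have "bij_betw h (f ` A) (g ` A)"
    unfolding bij_betw_def
  proof
    show "inj_on h (f ` A)"
      using h assms by (auto intro!: inj_onI)
    show "h ` f ` A = g ` A"
      unfolding image_image using h by (rule image_cong[OF refl])
  qed
  then show ?thesis
    unfolding eqpoll_def by blast
qed

text \<open>\<open>R\<close> is a relation because the constructions involve choices of a hub and of
  a partition. One direction of \<open>iff\<close> makes the induced map well defined on classes,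
  the other makes it injective.\<close>

lemma unlabeled_eqpoll:
  assumes PQ: "\<And>G. simple_graph G \<Longrightarrow> P G \<Longrightarrow> \<exists>H. simple_graph H \<and> Q H \<and> R G H"
    and QP: "\<And>H. simple_graph H \<Longrightarrow> Q H \<Longrightarrow> \<exists>G. simple_graph G \<and> P G \<and> R G H"
    and iff: "\<And>G G' H H'. simple_graph G \<Longrightarrow> simple_graph G' \<Longrightarrow> simple_graph H \<Longrightarrow>
      simple_graph H' \<Longrightarrow> R G H \<Longrightarrow> R G' H' \<Longrightarrow> isomorphic G G' \<longleftrightarrow> isomorphic H H'"
  shows "unlabeled P \<approx> unlabeled Q"
proof -
  obtain h where h: "\<And>G. simple_graph G \<Longrightarrow> P G \<Longrightarrow> simple_graph (h G) \<and> Q (h G) \<and> R G (h G)"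
    using PQ by metis
  let ?cl = "\<lambda>G. iso_rel `` {G}" and ?X = "{G. simple_graph G \<and> P G}"
  have "?cl ` ?X \<approx> (\<lambda>G. ?cl (h G)) ` ?X"
  proof (rule image_eqpoll_image)
    fix G G' assume "G \<in> ?X" "G' \<in> ?X"
    then have G: "simple_graph G" "P G" "simple_graph G'" "P G'"
      by simp_all
    have "isomorphic G G' \<longleftrightarrow> isomorphic (h G) (h G')"
      using iff[OF G(1,3)] h[OF G(1,2)] h[OF G(3,4)] by blast
    then show "?cl G = ?cl G' \<longleftrightarrow> ?cl (h G) = ?cl (h G')"
      using iso_class_eq_iff[OF G(1,3)] iso_class_eq_iff[of "h G" "h G'"]
        h[OF G(1,2)] h[OF G(3,4)] by simp
  qed
  moreover have "(\<lambda>G. ?cl (h G)) ` ?X = unlabeled Q"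
  proof
    show "(\<lambda>G. ?cl (h G)) ` ?X \<subseteq> unlabeled Q"
      using h unfolding unlabeled_conv_image by blast
    show "unlabeled Q \<subseteq> (\<lambda>G. ?cl (h G)) ` ?X"
    proof
      fix X assume "X \<in> unlabeled Q"
      then obtain H where H: "simple_graph H" "Q H" "X = ?cl H"
        unfolding unlabeled_conv_image by blast
      then obtain G where G: "simple_graph G" "P G" "R G H"
        using QP by blast
      \<comment> \<open>The case \<open>G = G'\<close> of \<open>iff\<close>: any two partners of
        \<open>G\<close> are isomorphic, so the chosen one represents the class of
        \<open>H\<close>.\<close>
      then have "isomorphic H (h G)"
        using iff[OF G(1) G(1) H(1) _ G(3)] h isomorphic_refl by blast
      then have "X = ?cl (h G)"
        using H h[OF G(1,2)] iso_class_eq_iff by simp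
      then show "X \<in> (\<lambda>G. ?cl (h G)) ` ?X"
        using G by blast
    qed
  qed
  ultimately show ?thesis
    unfolding unlabeled_conv_image[of P] by simp
qed

section \<open>Removing a hub vertex\<close>

lemma split_partition_graph_iso:
  assumes "split_partition G K S" "graph_iso f G H"
  shows "split_partition H (f ` K) (f ` S)"
proof -
  have KS: "K \<subseteq> verts G" "S \<subseteq> verts G" "K \<union> S = verts G" "K \<inter> S = {}"
    using assms(1) by (auto simp: split_partition_def)
  have "f ` K \<inter> f ` S = {}"
    using inj_on_image_Int[OF graph_iso_inj[OF assms(2)] KS(1,2)] KS(4) by simp
  moreover have "f ` K \<union> f ` S = verts H"
    using graph_iso_image[OF assms(2)] KS(3) by (simp flip: image_Un)
  ultimately show ?thesis
    using assms(1) clique_graph_iso[OF assms(2) KS(1)] indep_graph_iso[OF assms(2) KS(2)]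
    by (simp add: split_partition_def)
qed

lemma split_graph_isomorphic:
  "isomorphic G H \<Longrightarrow> split_graph G \<Longrightarrow> split_graph H"
  unfolding split_graph_def using isomorphicE split_partition_graph_iso by metis

lemma independence_number_isomorphic:
  assumes "isomorphic G H"
  shows "independence_number G = independence_number H"
  using assms graph_iso_complement isomorphicE isomorphicI clique_number_isomorphic
    clique_number_complement by metis

lemma balanced_split_isomorphic:
  assumes "simple_graph G" "isomorphic G H" "balanced_split G"
  shows "balanced_split H"
proof -
  obtain f where f: "graph_iso f G H"
    using assms(2) by (rule isomorphicE)
  obtain K S where KS: "split_partition G K S"
    "card K = clique_number G" "card S = independence_number G"
    using assms(3) unfolding balanced_split_def by blast
  then have "inj_on f K" "inj_on f S"
    using graph_iso_inj[OF f] split_partitionD(1)[OF assms(1) KS(1)] by (simp_all add: inj_on_Un)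
  then have "card (f ` K) = clique_number H" "card (f ` S) = independence_number H"
    using KS clique_number_isomorphic[OF assms(2)] independence_number_isomorphic[OF assms(2)]
    by (simp_all add: card_image)
  then show ?thesis
    using split_partition_graph_iso[OF KS(1) f] unfolding balanced_split_def by blast
qed

text \<open>Two split partitions with a maximum clique side differ by exchanging two vertices with the
  same neighbours.\<close>

lemma maximum_split_partition_unique:
  assumes "simple_graph G" "split_partition G K S" "split_partition G K' S'" "card K = card K'"
  obtains f where "graph_iso f G G" "f ` K = K'" "f ` S = S'"
proof (cases "K = K'")
  case True
  then have "S = S'"
    using split_partitionD(1,2)[OF assms(1,2)] split_partitionD(1,2)[OF assms(1,3)] by blast
  moreover have "graph_iso id G G"
    by (simp add: graph_iso_def)
  ultimately show thesis
    using that[of id] True by simp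
next
  case False
  note h = split_partitionD[OF assms(1,2)] and h' = split_partitionD[OF assms(1,3)]
  have sub: "K - K' \<subseteq> S'" "K' - K \<subseteq> S"
    using h(1) h'(1) by auto
  have "clique (K - K') (edges G)" "clique (K' - K) (edges G)"
    using h(3) h'(3) smaller_clique by (metis Diff_subset)+
  \<comment> \<open>Equal sizes make both differences nonempty. Each is a clique inside a stable
    set, hence a single vertex.\<close>
  moreover have "K - K' \<noteq> {}" "K' - K \<noteq> {}"
    using False assms(4) h(5) h'(5) card_subset_eq by (metis Diff_eq_empty_iff)+
  ultimately obtain a b where a: "K - K' = {a}" and b: "K' - K = {b}"
    using card_clique_indep_le_1[OF _ h'(4) sub(1)] card_clique_indep_le_1[OF _ h(4) sub(2)]
    by blast
  have ab: "a \<in> K" "a \<notin> K'" "a \<in> S'" "a \<notin> S" "b \<in> K'" "b \<notin> K" "b \<in> S" "b \<notin> S'" "a \<noteq> b"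
    using a b sub h(2) h'(2) by blast+
  have K': "K' = insert b (K - {a})"
    using a b by blast
  have S': "S' = insert a (S - {b})"
  proof -
    have "S' = (K \<union> S) - K'"
      using h(1) h'(1,2) by auto
    then show ?thesis
      using K' ab h(2) by auto
  qed
  \<comment> \<open>A vertex in both cliques is adjacent to \<open>a\<close> and to
    \<open>b\<close>, one in both stable sets to neither; so these are twins.\<close>
  have "graph_iso (transpose a b) G G"
  proof (rule graph_iso_transpose[OF assms(1)])
    show "a \<in> verts G" "b \<in> verts G"
      using ab h(1) by auto
    fix w assume w: "w \<in> verts G - {a, b}"
    show "{w, a} \<in> edges G \<longleftrightarrow> {w, b} \<in> edges G"
    proof (cases "w \<in> K")
      case True
      then have "w \<in> K'"
        using w K' by simp
      then show ?thesis
        using True h(3) h'(3) ab w by (simp add: clique_def)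
    next
      case False
      then have "w \<in> S" "w \<in> S'"
        using w h(1) S' by auto
      then show ?thesis
        using h(4) h'(4) ab w by (simp add: indep_def)
    qed
  qed
  moreover have "transpose a b ` K = K'" "transpose a b ` S = S'"
    using ab unfolding K' S' by (auto simp: transpose_def image_iff)
  ultimately show thesis
    by (rule that)
qed

text \<open>If some vertex of \<open>S\<close> is joined to all of \<open>K\<close>, moving it over
  raises the clique side to the clique number.\<close>

lemma ex_maximum_split_partition:
  assumes "simple_graph G" "split_graph G"
  obtains K S where "split_partition G K S" "card K = clique_number G"
proof -
  obtain K S where KS: "split_partition G K S"
    using assms(2) unfolding split_graph_def by blast
  note h = split_partitionD[OF assms(1) KS]
  show thesis
  proof (cases "\<exists>s\<in>S. \<forall>k\<in>K. {k, s} \<in> edges G")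
    case False
    then have "card K = clique_number G"
      using clique_number_split[OF assms(1) KS] by argo
    then show ?thesis
      using that KS by blast
  next
    case True
    then obtain s where s: "s \<in> S" "\<forall>k\<in>K. {k, s} \<in> edges G" by blast
    have "clique (insert s K) (edges G)"
      using h(3) s(2) by (auto simp: clique_def insert_commute)
    moreover have "indep (S - {s}) (edges G)"
      using h(4) smaller_indep by blast
    ultimately have "split_partition G (insert s K) (S - {s})"
      using h(1,2) s(1) by (auto simp: split_partition_def)
    moreover have "s \<notin> K"
      using s(1) h(2) by blast
    then have "card (insert s K) = clique_number G"
      using clique_number_split[OF assms(1) KS] True h(5) by simp
    ultimately show ?thesis
      by (rule that)
  qed
qed

text \<open>The condition on \<open>card K\<close> is the criterion for \<open>NG1_graph\<close>; it
  also fixes the sides of the remaining split graph up to an automorphism, so that the removal can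
  be undone.\<close>

definition hub_removal :: "'a graph \<Rightarrow> 'b graph \<Rightarrow> bool" where
  "hub_removal G H \<longleftrightarrow> (\<exists>a K S. hub_partition G {a} K S \<and>
     card K = clique_number (induced G (K \<union> S)) \<and> isomorphic (induced G (K \<union> S)) H)"

lemma hub_removalE:
  assumes "hub_removal G H"
  obtains a K S where "hub_partition G {a} K S" "card K = clique_number (induced G (K \<union> S))"
    "isomorphic (induced G (K \<union> S)) H"
  using assms unfolding hub_removal_def by blast

lemma hub_removal_properties:
  assumes "hub_removal G H" "simple_graph H"
  shows "NG1_graph G" "split_graph H" "NG2_graph G \<longleftrightarrow> balanced_split H"
    "card (verts G) = card (verts H) + 1"
proof -
  obtain a K S where hub: "hub_partition G {a} K S"
    and K: "card K = clique_number (induced G (K \<union> S))" and iso: "isomorphic (induced G (K \<union> S)) H"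
    using assms(1) by (rule hub_removalE)
  note h = hub_partitionD[OF hub] and sp = split_partition_hub[OF hub]
  show "NG1_graph G"
    using K NG1_graph_hub_iff_clique_number[OF hub] by simp
  then show "NG2_graph G \<longleftrightarrow> balanced_split H"
    using NG1_NG2_graph_hub_iff_balanced[OF hub] balanced_split_isomorphic[OF sp(2) iso]
      balanced_split_isomorphic[OF assms(2) isomorphic_sym[OF iso]] by blast
  show "split_graph H"
    using split_graph_isomorphic[OF iso] sp(1) unfolding split_graph_def by blast
  have "card (K \<union> S) = card (verts H)"
    using isomorphic_card[OF iso] by simp
  then show "card (verts G) = card (verts H) + 1"
    using h(2-4,13,14) by simp
qed

lemma ex_hub_removal:
  fixes G :: "'a graph"
  assumes "simple_graph G" "NG1_graph G"
  obtains H :: "'a graph" where "simple_graph H" "hub_removal G H"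
proof -
  obtain a K S where hub: "hub_partition G {a} K S"
    using assms NG1_or_NG2_graph_iff_unbalanced_split unbalanced_split_iff_hub by metis
  then have "hub_removal G (induced G (K \<union> S))"
    using NG1_graph_hub_iff_clique_number[OF hub] assms(2) isomorphic_refl
    unfolding hub_removal_def by blast
  then show thesis
    using split_partition_hub(2)[OF hub] that by blast
qed

lemma simple_graph_single: "simple_graph ({a}, {})"
  by (simp add: simple_graph_def)

text \<open>A maximum split partition of \<open>H\<close> prescribes how to attach a new vertex: to
  the whole clique side and to nothing else.\<close>

lemma hub_removal_surj:
  fixes H :: "nat graph"
  assumes "simple_graph H" "split_graph H"
  obtains G :: "nat graph" where "simple_graph G" "hub_removal G H"
proof -
  obtain K S where KS: "split_partition H K S" "card K = clique_number H"
    using assms by (rule ex_maximum_split_partition)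
  obtain G :: "nat graph" and D where G: "hub_partition G D K S" "induced G (K \<union> S) = H"
    and "card D = card (verts ({0 :: nat}, {} :: nat set set))"
    using assms(1) KS(1) simple_graph_single by (rule ex_hub_partition)
  then obtain a where "D = {a}"
    by (auto simp: card_1_singleton_iff)
  then have "hub_removal G H"
    using G KS(2) isomorphic_refl unfolding hub_removal_def by metis
  then show thesis
    using hub_partitionD(1)[OF G(1)] that by blast
qed

lemma isomorphic_induced_single:
  assumes "simple_graph G" "simple_graph H"
  shows "isomorphic (induced G {a}) (induced H {b})"
  unfolding isomorphic_def using simple_graph_no_loop[OF assms(1)] simple_graph_no_loop[OF assms(2)]
  by (intro exI[of _ "\<lambda>_. b"]) (auto simp: bij_betw_def induced_def)

text \<open>An isomorphism of the larger graphs can be made to respect the hubs. One of the smaller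
  graphs carries \<open>K\<close> to the clique side of some maximum split partition, which need not
  be \<open>K'\<close>; an automorphism corrects this before the hub vertices are glued
  back.\<close>

lemma hub_removal_isomorphic_iff:
  assumes "simple_graph H" "simple_graph H'" "hub_removal G H" "hub_removal G' H'"
  shows "isomorphic G G' \<longleftrightarrow> isomorphic H H'"
proof -
  obtain a K S where hub: "hub_partition G {a} K S"
    and K: "card K = clique_number (induced G (K \<union> S))" and iso: "isomorphic (induced G (K \<union> S)) H"
    using assms(3) by (rule hub_removalE)
  obtain a' K' S' where hub': "hub_partition G' {a'} K' S'"
    and K': "card K' = clique_number (induced G' (K' \<union> S'))"
    and iso': "isomorphic (induced G' (K' \<union> S')) H'"
    using assms(4) by (rule hub_removalE)
  note sp = split_partition_hub[OF hub] and sp' = split_partition_hub[OF hub']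
  let ?H = "induced G (K \<union> S)" and ?H' = "induced G' (K' \<union> S')"
  have "isomorphic G G' \<longleftrightarrow> isomorphic ?H ?H'"
  proof
    assume "isomorphic G G'"
    with hub hub' obtain f where f: "graph_iso f G G'" "f ` K = K'" "f ` S = S'"
      by (rule isomorphic_hub_singleE)
    then show "isomorphic ?H ?H'"
      using graph_iso_induced[OF f(1), of "K \<union> S"] hub_partitionD(2)[OF hub]
      by (auto simp: image_Un intro: isomorphicI)
  next
    assume "isomorphic ?H ?H'"
    then obtain g where g: "graph_iso g ?H ?H'"
      by (rule isomorphicE)
    have "split_partition ?H' (g ` K) (g ` S)"
      using split_partition_graph_iso[OF sp(1) g] .
    moreover have "inj_on g K"
      using graph_iso_inj[OF g] by (simp add: inj_on_Un)
    then have "card (g ` K) = card K'"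
      using K K' clique_number_isomorphic[OF isomorphicI[OF g]] by (simp add: card_image)
    ultimately obtain f where f: "graph_iso f ?H' ?H'" "f ` g ` K = K'" "f ` g ` S = S'"
      using maximum_split_partition_unique[OF sp'(2) _ sp'(1)] by metis
    show "isomorphic G G'"
    proof (rule isomorphic_hub_glue[OF hub hub'])
      show "isomorphic (induced G {a}) (induced G' {a'})"
        using hub_partitionD(1)[OF hub] hub_partitionD(1)[OF hub']
        by (rule isomorphic_induced_single)
      show "graph_iso (f \<circ> g) ?H ?H'"
        using graph_iso_comp[OF g f(1)] .
      show "(f \<circ> g) ` K = K'" "(f \<circ> g) ` S = S'"
        using f(2,3) by (simp_all add: image_comp)
    qed
  qed
  also have "\<dots> \<longleftrightarrow> isomorphic H H'"
    using iso iso' isomorphic_sym isomorphic_trans by metis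
  finally show ?thesis .
qed

text \<open>Common frame for counting NG-1 and its two subclasses inside and outside NG-2: only the
  matching of \<open>P\<close> with \<open>Q\<close> along the removal varies.\<close>

lemma hub_removal_eqpoll:
  assumes "\<And>G H. simple_graph G \<Longrightarrow> simple_graph H \<Longrightarrow> hub_removal G H \<Longrightarrow> P G \<longleftrightarrow> Q H"
    and "\<And>G. P G \<Longrightarrow> NG1_graph G" "\<And>H. Q H \<Longrightarrow> split_graph H"
  shows "unlabeled P \<approx> unlabeled Q"
proof (rule unlabeled_eqpoll)
  show "\<exists>H. simple_graph H \<and> Q H \<and> hub_removal G H" if "simple_graph G" "P G" for G
    using ex_hub_removal[OF that(1) assms(2)[OF that(2)]] assms(1) that by metis
  show "\<exists>G. simple_graph G \<and> P G \<and> hub_removal G H" if "simple_graph H" "Q H" for H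
    using hub_removal_surj[OF that(1) assms(3)[OF that(2)]] assms(1) that by metis
  show "isomorphic G G' \<longleftrightarrow> isomorphic H H'"
    if "simple_graph H" "simple_graph H'" "hub_removal G H" "hub_removal G' H'" for G G' H H'
    using that by (rule hub_removal_isomorphic_iff)
qed

section \<open>Hubs inducing a 5-cycle\<close>

text \<open>Reduces statements about the vertices of the cycle to finitely many cases.\<close>

lemma all_less_5: "(\<forall>i<5. P (i::nat)) \<longleftrightarrow> P 0 \<and> P 1 \<and> P 2 \<and> P 3 \<and> P 4"
proof -
  have lessThan_5: "{..<5} = {0, 1, 2, 3, 4::nat}"
    by auto
  have "(\<forall>i<5. P i) \<longleftrightarrow> (\<forall>i\<in>{..<5}. P i)"
    by (simp only: Ball_def lessThan_iff)
  then show ?thesis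
    unfolding lessThan_5 by simp
qed

text \<open>Adding 4 modulo 5 is one step back; the predecessor written in this way needs no
  truncated subtraction.\<close>

lemma cycle5_edge:
  assumes "i < 5" "j < 5"
  shows "{i, j} \<in> edges cycle5 \<longleftrightarrow> j = (i + 1) mod 5 \<or> j = (i + 4) mod 5"
proof -
  have "{i, j} \<in> edges cycle5 \<longleftrightarrow> j = (i + 1) mod 5 \<or> i = (j + 1) mod 5"
    using assms by (auto simp: cycle5_def doubleton_eq_iff)
  also have "i = (j + 1) mod 5 \<longleftrightarrow> j = (i + 4) mod 5"
  proof -
    have "\<forall>i<5. \<forall>j<5. i = (j + 1) mod 5 \<longleftrightarrow> j = (i + 4) mod (5 :: nat)"
      unfolding all_less_5 by simp
    then show ?thesis
      using assms by blast
  qed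
  finally show ?thesis .
qed

section \<open>The 5-cycle: chromatic number and self-complementarity\<close>

lemma verts_cycle5 [simp]: "verts cycle5 = {..<5}"
  by (simp add: cycle5_def)

lemma simple_graph_cycle5: "simple_graph cycle5"
proof -
  have "\<forall>i<5. i \<noteq> (i + 1) mod (5 :: nat)"
    unfolding all_less_5 by simp
  then show ?thesis
    by (auto simp: simple_graph_def cycle5_def nsets_def card_2_iff doubleton_eq_iff)
qed

lemma colorable_cycle5_3: "colorable cycle5 3"
proof -
  \<comment> \<open>The colours 0 and 1 alternate along the cycle; vertex 4 would clash with vertex
    0 and gets a third colour.\<close>
  let ?c = "\<lambda>i::nat. if i = 4 then 2 else i mod 2"
  have "\<forall>i<5. \<forall>j<5. {i, j} \<in> edges cycle5 \<longrightarrow> ?c i \<noteq> ?c j"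
    unfolding all_less_5 by (simp add: cycle5_edge simple_graph_no_loop[OF simple_graph_cycle5])
  moreover have "?c ` {..<5} \<subseteq> {..<3}"
    by auto
  ultimately show ?thesis
    unfolding colorable_def by (intro exI[of _ ?c]) auto
qed

lemma not_colorable_cycle5_2: "\<not> colorable cycle5 2"
proof
  assume "colorable cycle5 2"
  then obtain c :: "nat \<Rightarrow> nat" where c: "c ` {..<5} \<subseteq> {..<2}"
    and proper: "\<And>i j. i < 5 \<Longrightarrow> j < 5 \<Longrightarrow> {i, j} \<in> edges cycle5 \<Longrightarrow> c i \<noteq> c j"
    by (rule colorableE) (rule that, unfold verts_cycle5 lessThan_iff, assumption, blast)
  have two: "c i = 0 \<or> c i = 1" if "i < 5" for i
    using c that by (force simp: less_2_cases_iff)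
  have "c 0 \<noteq> c 1"
    by (rule proper) (simp_all add: cycle5_edge)
  moreover have "c 1 \<noteq> c 2"
    by (rule proper) (simp_all add: cycle5_edge)
  moreover have "c 2 \<noteq> c 3"
    by (rule proper) (simp_all add: cycle5_edge)
  moreover have "c 3 \<noteq> c 4"
    by (rule proper) (simp_all add: cycle5_edge)
  moreover have "c 4 \<noteq> c 0"
    by (rule proper) (simp_all add: cycle5_edge)
  ultimately show False
    using two[of 0] two[of 1] two[of 2] two[of 3] two[of 4] by (simp, metis)
qed

lemma chromatic_number_cycle5: "chromatic_number cycle5 = 3"
proof (rule antisym)
  show "chromatic_number cycle5 \<le> 3"
    using colorable_cycle5_3 colorable_iff_chromatic_number_le[OF simple_graph_cycle5] by simp
  have "\<not> chromatic_number cycle5 \<le> 2"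
    using not_colorable_cycle5_2 colorable_iff_chromatic_number_le[OF simple_graph_cycle5] by simp
  then show "3 \<le> chromatic_number cycle5"
    by simp
qed

text \<open>Distinct non-adjacent vertices differ by 2 or 3 modulo 5. Doubling turns this into a
  difference of 4 or 1, that is, into an edge.\<close>

lemma isomorphic_complement_cycle5: "isomorphic (complement cycle5) cycle5"
proof -
  have "\<forall>i<5. \<forall>j<5. {i, j} \<in> edges (complement cycle5) \<longleftrightarrow>
      {2 * i mod 5, 2 * j mod 5} \<in> edges cycle5"
    unfolding all_less_5
    by (simp add: cycle5_edge edges_complement simple_graph_no_loop simple_graph_cycle5
        simple_graph_complement)
  moreover have "bij_betw (\<lambda>i::nat. 2 * i mod 5) {..<5} {..<5}"
  proof -
    have "{..<5} = {0, 1, 2, 3, 4::nat}"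
      by auto
    then show ?thesis
      by (auto simp: bij_betw_def inj_on_def)
  qed
  ultimately show ?thesis
    unfolding isomorphic_def by (intro exI[of _ "\<lambda>i. 2 * i mod 5"]) simp
qed

lemma NG_graph_cycle5: "NG_graph cycle5"
  using chromatic_number_isomorphic[OF isomorphic_complement_cycle5]
  by (simp add: NG_graph_def chromatic_number_cycle5)

lemma cycle5_degree_within:
  assumes g: "graph_iso g cycle5 (induced G A)" and "D \<subseteq> A" "i < 5"
  shows "card {u \<in> D. {u, g i} \<in> edges G} =
    of_bool (g ((i + 1) mod 5) \<in> D) + of_bool (g ((i + 4) mod 5) \<in> D)"
proof -
  let ?p = "(i + 1) mod 5" and ?q = "(i + 4) mod 5"
  have img: "g ` {..<5} = A" and inj: "inj_on g {..<5}"
    using graph_iso_image[OF g] graph_iso_inj[OF g] by simp_all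
  have "\<forall>i<5. (i + 1) mod 5 \<noteq> (i + 4) mod (5 :: nat)"
    unfolding all_less_5 by simp
  then have "?p \<noteq> ?q"
    using assms(3) by blast
  have nbr: "{g j, g i} \<in> edges G \<longleftrightarrow> j = ?p \<or> j = ?q" if "j < 5" for j
  proof -
    have "g i \<in> A" "g j \<in> A"
      using img that assms(3) by auto
    then show ?thesis
      using graph_iso_edge[OF g, of i j] cycle5_edge[OF assms(3) that] that assms(3)
      by (simp add: edges_induced insert_commute)
  qed
  have "{u \<in> D. {u, g i} \<in> edges G} = g ` {j \<in> {?p, ?q}. g j \<in> D}"
  proof (intro equalityI subsetI)
    fix u assume u: "u \<in> {u \<in> D. {u, g i} \<in> edges G}"
    then obtain j where "j < 5" "u = g j"
      using img assms(2) by blast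
    then show "u \<in> g ` {j \<in> {?p, ?q}. g j \<in> D}"
      using u nbr[of j] by blast
  next
    fix u assume "u \<in> g ` {j \<in> {?p, ?q}. g j \<in> D}"
    then obtain j where "j \<in> {?p, ?q}" "g j \<in> D" "u = g j"
      by blast
    moreover from this have "j < 5"
      by auto
    ultimately show "u \<in> {u \<in> D. {u, g i} \<in> edges G}"
      using nbr by simp
  qed
  also have "card \<dots> = card {j \<in> {?p, ?q}. g j \<in> D}"
    by (intro card_image inj_on_subset[OF inj]) auto
  also have "{j \<in> {?p, ?q}. g j \<in> D} = (if g ?p \<in> D then {?p} else {}) \<union> (if g ?q \<in> D then {?q} else {})"
    by auto
  also have "card \<dots> = of_bool (g ?p \<in> D) + of_bool (g ?q \<in> D)"
    using \<open>?p \<noteq> ?q\<close> by simp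
  finally show ?thesis .
qed

text \<open>The booleans \<open>p\<close>, \<open>q\<close>, \<open>u\<close>, \<open>s\<close>,
  \<open>t\<close> tell which of the vertices 0, 1, 2, 3, 4 are chosen. The alternatives for a
  choice of constant degree \<open>r\<close> are: everything, no non-adjacent pair, no adjacent
  pair.\<close>

lemma regular_pattern_on_5_cycle:
  assumes "p \<longrightarrow> of_bool q + of_bool t = r" "q \<longrightarrow> of_bool u + of_bool p = r"
    "u \<longrightarrow> of_bool s + of_bool q = r" "s \<longrightarrow> of_bool t + of_bool u = r"
    "t \<longrightarrow> of_bool p + of_bool s = (r :: nat)"
  shows "(p \<and> q \<and> u \<and> s \<and> t) \<or>
    \<not> (p \<and> u \<or> q \<and> s \<or> u \<and> t \<or> s \<and> p \<or> t \<and> q) \<or>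
    \<not> (p \<and> q \<or> q \<and> u \<or> u \<and> s \<or> s \<and> t \<or> t \<and> p)"
  using assms by (cases p; cases q; cases u; cases s; cases t) auto

lemma regular_subset_of_cycle5:
  assumes iso: "isomorphic (induced G A) cycle5" and "D \<subseteq> A"
    and reg: "\<And>v. v \<in> D \<Longrightarrow> card {u \<in> D. {u, v} \<in> edges G} = r"
  shows "clique D (edges G) \<or> indep D (edges G) \<or> D = A"
proof -
  obtain g where g: "graph_iso g cycle5 (induced G A)"
    using isomorphic_sym[OF iso] by (rule isomorphicE)
  have img: "g ` {..<5} = A"
    using graph_iso_image[OF g] by simp
  define b where "b i \<longleftrightarrow> g i \<in> D" for i
  have "of_bool (b ((i + 1) mod 5)) + of_bool (b ((i + 4) mod 5)) = r" if "i < 5" "b i" for i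
    using cycle5_degree_within[OF g assms(2) that(1)] reg[of "g i"] that(2) by (simp add: b_def)
  note this[of 0] this[of 1] this[of 2] this[of 3] this[of 4]
  then have f: "b 0 \<longrightarrow> of_bool (b 1) + of_bool (b 4) = r" "b 1 \<longrightarrow> of_bool (b 2) + of_bool (b 0) = r"
    "b 2 \<longrightarrow> of_bool (b 3) + of_bool (b 1) = r" "b 3 \<longrightarrow> of_bool (b 4) + of_bool (b 2) = r"
    "b 4 \<longrightarrow> of_bool (b 0) + of_bool (b 3) = r"
    by (simp_all add: numeral_2_eq_2[symmetric])
  have "(\<forall>i<5. b i) \<or>
      (\<forall>i<5. \<forall>j<5. b i \<longrightarrow> b j \<longrightarrow> i \<noteq> j \<longrightarrow> {i, j} \<in> edges cycle5) \<or>
      (\<forall>i<5. \<forall>j<5. b i \<longrightarrow> b j \<longrightarrow> i \<noteq> j \<longrightarrow> {i, j} \<notin> edges cycle5)"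
    using regular_pattern_on_5_cycle[OF f] unfolding all_less_5 by (auto simp: cycle5_edge)
  moreover have D: "\<exists>i<5. u = g i \<and> b i" if "u \<in> D" for u
    using that assms(2) img by (auto simp: b_def)
  moreover have edge: "{g i, g j} \<in> edges G \<longleftrightarrow> {i, j} \<in> edges cycle5" if "i < 5" "j < 5" for i j
    using graph_iso_edge[OF g, of i j] that img by (auto simp: edges_induced)
  have "clique D (edges G)"
    if "\<forall>i<5. \<forall>j<5. b i \<longrightarrow> b j \<longrightarrow> i \<noteq> j \<longrightarrow> {i, j} \<in> edges cycle5"
    unfolding clique_def using D edge that by metis
  moreover have "indep D (edges G)"
    if "\<forall>i<5. \<forall>j<5. b i \<longrightarrow> b j \<longrightarrow> i \<noteq> j \<longrightarrow> {i, j} \<notin> edges cycle5"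
    unfolding indep_def using D edge that by metis
  moreover have "D = A" if "\<forall>i<5. b i"
    using that img assms(2) by (auto simp: b_def)
  ultimately show ?thesis by blast
qed

lemma cycle5_not_clique_or_indep:
  assumes "isomorphic (induced G A) cycle5"
  shows "\<not> clique A (edges G)" "\<not> indep A (edges G)"
proof -
  obtain g where g: "graph_iso g cycle5 (induced G A)"
    using isomorphic_sym[OF assms] by (rule isomorphicE)
  have A: "g i \<in> A" if "i < 5" for i
    using graph_iso_image[OF g] that by auto
  have edge: "{g i, g j} \<in> edges G \<longleftrightarrow> {i, j} \<in> edges cycle5" if "i < 5" "j < 5" for i j
    using graph_iso_edge[OF g, of i j] that A by (simp add: edges_induced)
  have ne: "g 0 \<noteq> g 1" "g 0 \<noteq> g 2"
    using inj_onD[OF graph_iso_inj[OF g], of 0 1] inj_onD[OF graph_iso_inj[OF g], of 0 2] by auto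
  have "{g 0, g 1} \<in> edges G" "{g 0, g 2} \<notin> edges G"
    by (simp_all add: edge cycle5_edge)
  then show "\<not> clique A (edges G)" "\<not> indep A (edges G)"
    using A[of 0] A[of 1] A[of 2] ne by (auto simp: clique_def indep_def)
qed

text \<open>The chromatic number is \<open>card K + 3\<close>, so the threshold degree is
  \<open>card K + 2\<close>. Vertices of \<open>D\<close> meet it, those of \<open>K\<close> exceed
  it by at least two, and those of \<open>S\<close> have at most \<open>card K\<close> neighbours;
  thus the part A recovers the hub.\<close>

lemma hub_cycle5:
  assumes "hub_partition G D K S" "isomorphic (induced G D) cycle5"
  shows "NG_graph G" "A_part G = D" "card D = 5"
proof -
  note h = hub_partitionD[OF assms(1)]
  show cD: "card D = 5"
    using isomorphic_card[OF assms(2)] by simp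
  then have ne: "D \<noteq> {}"
    by auto
  show "NG_graph G"
    using NG_graph_hub_iff[OF assms(1) ne] NG_graph_isomorphic[OF assms(2)] NG_graph_cycle5 by simp
  have chi: "chromatic_number G = card K + 3"
    using chromatic_number_hub[OF assms(1) ne] chromatic_number_isomorphic[OF assms(2)]
    by (simp add: chromatic_number_cycle5)
  have A: "v \<in> A_part G \<longleftrightarrow> v \<in> verts G \<and> card {u \<in> verts G. {u, v} \<in> edges G} = card K + 2" for v
    by (simp add: A_part_def chi deg_conv_neighbours[OF h(1)])
  obtain g where g: "graph_iso g cycle5 (induced G D)"
    using isomorphic_sym[OF assms(2)] by (rule isomorphicE)
  have img: "g ` {..<5} = D"
    using graph_iso_image[OF g] by simp
  show "A_part G = D"
  proof (intro equalityI subsetI)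
    fix v assume v: "v \<in> D"
    then obtain i where i: "i < 5" "v = g i"
      using img by blast
    have "card {u \<in> D. {u, v} \<in> edges G} = 2"
      using cycle5_degree_within[OF g order_refl i(1)] i(2) img by auto
    moreover have "{u \<in> verts G. {u, v} \<in> edges G} = K \<union> {u \<in> D. {u, v} \<in> edges G}"
      using v h(2) h(9)[OF v] h(11)[OF v] by auto
    moreover have "card (K \<union> {u \<in> D. {u, v} \<in> edges G}) = card K + card {u \<in> D. {u, v} \<in> edges G}"
      using h(3,12,13) by (intro card_Un_disjoint) auto
    ultimately show "v \<in> A_part G"
      using v h(2) by (simp add: A)
  next
    fix v assume v: "v \<in> A_part G"
    show "v \<in> D"
    proof (rule ccontr)
      assume "v \<notin> D"
      then consider "v \<in> K" | "v \<in> S"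
        using v h(2) A by blast
      then show False
      proof cases
        case 1
        have "D \<union> (K - {v}) \<subseteq> {u \<in> verts G. {u, v} \<in> edges G}"
          using 1 h(2,6) h(8)[OF _ 1] by (auto simp: clique_def)
        then have "card (D \<union> (K - {v})) \<le> card K + 2"
          using v[unfolded A] finite_verts[OF h(1)]
            card_mono[of "{u \<in> verts G. {u, v} \<in> edges G}" "D \<union> (K - {v})"] by simp
        moreover have "card (D \<union> (K - {v})) = 5 + (card K - 1)"
          using h(3,12,13) 1 cD by (subst card_Un_disjoint) auto
        ultimately show False by simp
      next
        case 2
        have "{u, v} \<notin> edges G" if "u \<in> S" for u
          using h(7) 2 that simple_graph_edgeD(3)[OF h(1), of u v] by (auto simp: indep_def)
        then have "{u \<in> verts G. {u, v} \<in> edges G} \<subseteq> K"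
          using h(2) h(10)[OF _ 2] by auto
        then show False
          using v[unfolded A] card_mono[OF h(13), of "{u \<in> verts G. {u, v} \<in> edges G}"] by simp
      qed
    qed
  qed
qed

text \<open>A 5-cycle is neither a clique nor stable, so the graph is not an unbalanced split graph
  and its hub cannot be shrunk. Being a regular subset of the 5-cycle, the hub is then the whole
  part A.\<close>

lemma NG3_graph_iff_hub:
  assumes "simple_graph G"
  shows "NG3_graph G \<longleftrightarrow> (\<exists>D K S. hub_partition G D K S \<and> isomorphic (induced G D) cycle5)"
proof
  assume NG3: "NG3_graph G"
  then have NG: "NG_graph G" and iso: "isomorphic (induced G (A_part G)) cycle5"
    by (simp_all add: NG3_graph_def)
  obtain D K S r where D: "hub_partition G D K S" "D \<noteq> {}" "D \<subseteq> A_part G"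
    "\<And>v. v \<in> D \<Longrightarrow> card {u \<in> D. {u, v} \<in> edges G} = r"
    using NG_graph_hub[OF assms NG] by metis
  have "\<not> unbalanced_split G"
    using cycle5_not_clique_or_indep[OF iso] NG1_or_NG2_graph_iff_unbalanced_split[OF assms]
    by (simp add: NG1_graph_def NG2_graph_def)
  then have "\<not> clique D (edges G)" "\<not> indep D (edges G)"
    using ex_single_hub_if_clique[OF D(1)] ex_single_hub_if_indep[OF D(1)] D(2)
    unfolding unbalanced_split_iff_hub[OF assms] by blast+
  then have "D = A_part G"
    using regular_subset_of_cycle5[OF iso D(3) D(4)] by blast
  then show "\<exists>D K S. hub_partition G D K S \<and> isomorphic (induced G D) cycle5"
    using D(1) iso by blast
next
  assume "\<exists>D K S. hub_partition G D K S \<and> isomorphic (induced G D) cycle5"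
  then show "NG3_graph G"
    using hub_cycle5 unfolding NG3_graph_def by metis
qed

section \<open>Isomorphism classes determined by the outer part\<close>

lemma hub_partition_unique:
  assumes "hub_partition G D K S" "hub_partition G D K' S'" "D \<noteq> {}"
  shows "K = K'" "S = S'"
proof -
  note h = hub_partitionD[OF assms(1)] and h' = hub_partitionD[OF assms(2)]
  obtain d where d: "d \<in> D"
    using assms(3) by blast
  have "K \<inter> S' = {}" "K' \<inter> S = {}"
    using h(8,10)[OF d] h'(8,10)[OF d] by blast+
  moreover have "K \<union> S = K' \<union> S'"
    using h(2-4) h'(2-4) by auto
  ultimately show "K = K'" "S = S'"
    using h(5) h'(5) by blast+
qed

text \<open>The sides must be respected: the outer graph alone may have several split partitions,
  and the partition decides how the hub is attached.\<close>

definition outer_isomorphic ::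
    "'a graph \<Rightarrow> 'a set \<Rightarrow> 'a set \<Rightarrow> 'b graph \<Rightarrow> 'b set \<Rightarrow> 'b set \<Rightarrow> bool" where
  "outer_isomorphic G K S H K' S' \<longleftrightarrow>
     (\<exists>q. graph_iso q (induced G (K \<union> S)) (induced H (K' \<union> S')) \<and> q ` K = K' \<and> q ` S = S')"

lemma outer_isomorphic_refl:
  "induced G (K \<union> S) = induced H (K \<union> S) \<Longrightarrow> outer_isomorphic G K S H K S"
  unfolding outer_isomorphic_def by (intro exI[of _ id]) (simp add: graph_iso_def)

lemma outer_isomorphic_sym:
  assumes "outer_isomorphic G K S H K' S'"
  shows "outer_isomorphic H K' S' G K S"
proof -
  obtain q where q: "graph_iso q (induced G (K \<union> S)) (induced H (K' \<union> S'))" "q ` K = K'" "q ` S = S'"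
    using assms unfolding outer_isomorphic_def by blast
  let ?p = "inv_into (K \<union> S) q"
  have inj: "inj_on q (K \<union> S)" and bij: "bij_betw q (K \<union> S) (K' \<union> S')"
    using q(1) by (simp_all add: graph_iso_def bij_betw_def)
  have "{u, v} \<in> edges (induced H (K' \<union> S')) \<longleftrightarrow> {?p u, ?p v} \<in> edges (induced G (K \<union> S))"
    if "u \<in> K' \<union> S'" "v \<in> K' \<union> S'" for u v
    using graph_iso_edge[OF q(1), of "?p u" "?p v"] that bij_betw_inv_into_right[OF bij]
      bij_betwE[OF bij_betw_inv_into[OF bij]] by simp
  then have "graph_iso ?p (induced H (K' \<union> S')) (induced G (K \<union> S))"
    using bij_betw_inv_into[OF bij] by (simp add: graph_iso_def)
  moreover have "?p ` K' = K" "?p ` S' = S"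
    using inv_into_image_cancel[OF inj, of K] inv_into_image_cancel[OF inj, of S] q(2,3) by simp_all
  ultimately show ?thesis
    unfolding outer_isomorphic_def by blast
qed

lemma outer_isomorphic_trans:
  assumes "outer_isomorphic G K S H K' S'" "outer_isomorphic H K' S' J K'' S''"
  shows "outer_isomorphic G K S J K'' S''"
proof -
  obtain p where p: "graph_iso p (induced G (K \<union> S)) (induced H (K' \<union> S'))" "p ` K = K'" "p ` S = S'"
    using assms(1) unfolding outer_isomorphic_def by blast
  obtain q where q: "graph_iso q (induced H (K' \<union> S')) (induced J (K'' \<union> S''))"
      "q ` K' = K''" "q ` S' = S''"
    using assms(2) unfolding outer_isomorphic_def by blast
  have "(q \<circ> p) ` K = K''" "(q \<circ> p) ` S = S''"
    using p(2,3) q(2,3) unfolding image_comp[symmetric] by simp_all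
  with graph_iso_comp[OF p(1) q(1)] show ?thesis
    unfolding outer_isomorphic_def by blast
qed

lemma isomorphic_iff_outer_isomorphic_single:
  assumes "hub_partition G {a} K S" "hub_partition H {b} K' S'"
  shows "isomorphic G H \<longleftrightarrow> outer_isomorphic G K S H K' S'"
proof
  assume "isomorphic G H"
  with assms obtain f where f: "graph_iso f G H" "f ` K = K'" "f ` S = S'"
    by (rule isomorphic_hub_singleE)
  then show "outer_isomorphic G K S H K' S'"
    using graph_iso_induced[OF f(1), of "K \<union> S"] hub_partitionD(2)[OF assms(1)]
    unfolding outer_isomorphic_def by (auto simp: image_Un)
next
  assume "outer_isomorphic G K S H K' S'"
  then show "isomorphic G H"
    using isomorphic_hub_glue[OF assms isomorphic_induced_single] hub_partitionD(1)[OF assms(1)]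
      hub_partitionD(1)[OF assms(2)] unfolding outer_isomorphic_def by blast
qed

text \<open>Each hub is the part A of its graph, so every isomorphism carries hub to hub, and
  \<open>K\<close> and \<open>S\<close> follow. No correction by twins is required here, in contrast
  to one-vertex hubs.\<close>

lemma isomorphic_iff_outer_isomorphic_cycle5:
  assumes "hub_partition G D K S" "isomorphic (induced G D) cycle5"
    and "hub_partition H D' K' S'" "isomorphic (induced H D') cycle5"
  shows "isomorphic G H \<longleftrightarrow> outer_isomorphic G K S H K' S'"
proof
  note h = hub_partitionD[OF assms(1)] and h' = hub_partitionD[OF assms(3)]
  assume "isomorphic G H"
  then obtain f where f: "graph_iso f G H"
    by (rule isomorphicE)
  have "f ` D = D'"
    using A_part_graph_iso[OF f h(1) h'(1)] hub_cycle5(2)[OF assms(1,2)] hub_cycle5(2)[OF assms(3,4)]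
    by simp
  moreover have "D' \<noteq> {}"
    using hub_cycle5(3)[OF assms(3,4)] by auto
  ultimately have "f ` K = K'" "f ` S = S'"
    using hub_partition_unique[OF _ assms(3)] hub_partition_graph_iso[OF assms(1) f h'(1)] by simp_all
  then show "outer_isomorphic G K S H K' S'"
    using graph_iso_induced[OF f, of "K \<union> S"] h(2)
    unfolding outer_isomorphic_def by (auto simp: image_Un)
next
  assume "outer_isomorphic G K S H K' S'"
  moreover have "isomorphic (induced G D) (induced H D')"
    using assms(2) isomorphic_sym[OF assms(4)] by (rule isomorphic_trans)
  ultimately show "isomorphic G H"
    using isomorphic_hub_glue[OF assms(1,3)] unfolding outer_isomorphic_def by blast
qed

text \<open>The graphs need not share vertices: the outer parts agree up to a side-preserving
  isomorphism, with a 5-cycle as hub on one side and a vertex on the other.\<close>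

definition cycle5_contraction :: "'a graph \<Rightarrow> 'b graph \<Rightarrow> bool" where
  "cycle5_contraction G H \<longleftrightarrow> (\<exists>D K S a K' S'. hub_partition G D K S \<and>
     isomorphic (induced G D) cycle5 \<and> hub_partition H {a} K' S' \<and> outer_isomorphic G K S H K' S')"

lemma cycle5_contraction_isomorphic_iff:
  assumes "cycle5_contraction G H" "cycle5_contraction G' H'"
  shows "isomorphic G G' \<longleftrightarrow> isomorphic H H'"
proof -
  obtain D K S a L T where G: "hub_partition G D K S" "isomorphic (induced G D) cycle5"
    and H: "hub_partition H {a} L T" and GH: "outer_isomorphic G K S H L T"
    using assms(1) unfolding cycle5_contraction_def by blast
  obtain D' K' S' a' L' T' where G': "hub_partition G' D' K' S'" "isomorphic (induced G' D') cycle5"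
    and H': "hub_partition H' {a'} L' T'" and GH': "outer_isomorphic G' K' S' H' L' T'"
    using assms(2) unfolding cycle5_contraction_def by blast
  have "isomorphic G G' \<longleftrightarrow> outer_isomorphic G K S G' K' S'"
    using G G' by (rule isomorphic_iff_outer_isomorphic_cycle5)
  also have "\<dots> \<longleftrightarrow> outer_isomorphic H L T H' L' T'"
    using GH GH' outer_isomorphic_sym outer_isomorphic_trans by metis
  also have "\<dots> \<longleftrightarrow> isomorphic H H'"
    using isomorphic_iff_outer_isomorphic_single[OF H H'] by simp
  finally show ?thesis .
qed

lemma cycle5_contraction_card:
  assumes "cycle5_contraction G H"
  shows "card (verts G) = card (verts H) + 4"
proof -
  obtain D K S a L T where G: "hub_partition G D K S" "isomorphic (induced G D) cycle5"
    and H: "hub_partition H {a} L T" and GH: "outer_isomorphic G K S H L T"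
    using assms unfolding cycle5_contraction_def by blast
  note h = hub_partitionD[OF G(1)] and h' = hub_partitionD[OF H]
  have "isomorphic (induced G (K \<union> S)) (induced H (L \<union> T))"
    using GH isomorphicI unfolding outer_isomorphic_def by blast
  then have "card (K \<union> S) = card (L \<union> T)"
    using isomorphic_card by fastforce
  moreover have "card (verts G) = card D + card (K \<union> S)"
    unfolding h(2) using h(3,4,12-14) by (intro card_Un_disjoint) auto
  moreover have "card (verts H) = 1 + card (L \<union> T)"
    using h'(2-4,13,14) by simp
  ultimately show ?thesis
    using hub_cycle5(3)[OF G] by simp
qed

text \<open>An outer part can be completed by a 5-cycle or by one vertex, and together with its
  sides it determines either result up to isomorphism. The orders differ by 5 - 1 = 4.\<close>

lemma NG3_eqpoll_unbalanced:
  "of_order NG3 n \<approx> of_order Unbalanced (n - 4)"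
  unfolding NG3_def Unbalanced_def of_order_unlabeled
proof (rule unlabeled_eqpoll)
  fix G :: "nat graph"
  assume G: "simple_graph G" "NG3_graph G \<and> int (card (verts G)) = n"
  then obtain D K S where D: "hub_partition G D K S" "isomorphic (induced G D) cycle5"
    unfolding NG3_graph_iff_hub[OF G(1)] by blast
  obtain H :: "nat graph" and B where H: "hub_partition H B K S" "induced H (K \<union> S) = induced G (K \<union> S)"
    and "card B = card (verts ({0 :: nat}, {} :: nat set set))"
    using split_partition_hub(2,1)[OF D(1)] simple_graph_single by (rule ex_hub_partition)
  then obtain a where a: "B = {a}"
    by (auto simp: card_1_singleton_iff)
  have R: "cycle5_contraction G H"
    using D H(1)[unfolded a] outer_isomorphic_refl[OF H(2)[symmetric]]
    unfolding cycle5_contraction_def by blast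
  have "simple_graph H"
    using hub_partitionD(1)[OF H(1)] .
  moreover from this have "unbalanced_split H"
    using H(1) a unbalanced_split_iff_hub by blast
  moreover have "int (card (verts H)) = n - 4"
    using cycle5_contraction_card[OF R] G(2) by simp
  ultimately show "\<exists>H :: nat graph. simple_graph H \<and> (unbalanced_split H \<and> int (card (verts H)) = n - 4) \<and>
      cycle5_contraction G H"
    using R by blast
next
  fix H :: "nat graph"
  assume H: "simple_graph H" "unbalanced_split H \<and> int (card (verts H)) = n - 4"
  then obtain a K S where a: "hub_partition H {a} K S"
    unfolding unbalanced_split_iff_hub[OF H(1)] by blast
  obtain G :: "nat graph" and D where G: "hub_partition G D K S" "induced G (K \<union> S) = induced H (K \<union> S)"
    "isomorphic (induced G D) cycle5"
    using split_partition_hub(2,1)[OF a] simple_graph_cycle5 by (rule ex_hub_partition)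
  have R: "cycle5_contraction G H"
    using G(1,3) a outer_isomorphic_refl[OF G(2)] unfolding cycle5_contraction_def by blast
  have "simple_graph G"
    using hub_partitionD(1)[OF G(1)] .
  moreover from this have "NG3_graph G"
    using G(1,3) NG3_graph_iff_hub by blast
  moreover have "int (card (verts G)) = n"
    using cycle5_contraction_card[OF R] H(2) by simp
  ultimately show "\<exists>G :: nat graph. simple_graph G \<and> (NG3_graph G \<and> int (card (verts G)) = n) \<and>
      cycle5_contraction G H"
    using R by blast
next
  show "isomorphic G G' \<longleftrightarrow> isomorphic H H'"
    if "cycle5_contraction G H" "cycle5_contraction G' H'" for G G' H H' :: "nat graph"
    using that by (rule cycle5_contraction_isomorphic_iff)
qed

section \<open>The bijections\<close>

lemma iso_invariant_NG1: "iso_invariant NG1_graph"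
  using NG1_graph_isomorphic unfolding iso_invariant_def by blast

lemma iso_invariant_NG2: "iso_invariant NG2_graph"
  using NG2_graph_isomorphic unfolding iso_invariant_def by blast

lemma NG1_eqpoll_split: "of_order NG1 n \<approx> of_order Split (n - 1)"
  unfolding NG1_def Split_def of_order_unlabeled
proof (rule hub_removal_eqpoll)
  show "NG1_graph G \<and> int (card (verts G)) = n \<longleftrightarrow> split_graph H \<and> int (card (verts H)) = n - 1"
    if "simple_graph H" "hub_removal G H" for G H :: "nat graph"
    using hub_removal_properties[OF that(2,1)] by auto
qed simp_all

lemma NG1_inter_NG2_eqpoll_balanced: "of_order (NG1 \<inter> NG2) n \<approx> of_order Balanced (n - 1)"
  unfolding NG1_def NG2_def Balanced_def unlabeled_inter[OF iso_invariant_NG1 iso_invariant_NG2]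
    of_order_unlabeled
proof (rule hub_removal_eqpoll)
  show "(NG1_graph G \<and> NG2_graph G) \<and> int (card (verts G)) = n \<longleftrightarrow>
      balanced_split H \<and> int (card (verts H)) = n - 1"
    if "simple_graph H" "hub_removal G H" for G H :: "nat graph"
    using hub_removal_properties[OF that(2,1)] by auto
  show "split_graph H" if "balanced_split H \<and> int (card (verts H)) = n - 1"
    for H :: "nat graph"
    using that unfolding balanced_split_def split_graph_def by blast
qed simp

lemma NG1_diff_NG2_eqpoll_unbalanced: "of_order (NG1 - NG2) n \<approx> of_order Unbalanced (n - 1)"
  unfolding NG1_def NG2_def Unbalanced_def unlabeled_diff[OF iso_invariant_NG1 iso_invariant_NG2]
    of_order_unlabeled
proof (rule hub_removal_eqpoll)
  show "(NG1_graph G \<and> \<not> NG2_graph G) \<and> int (card (verts G)) = n \<longleftrightarrow>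
      unbalanced_split H \<and> int (card (verts H)) = n - 1"
    if "simple_graph H" "hub_removal G H" for G H :: "nat graph"
    using hub_removal_properties[OF that(2,1)] by (auto simp: unbalanced_split_def)
qed (simp_all add: unbalanced_split_def)

lemma unlabeled_complement_eqpoll:
  assumes "\<And>G. simple_graph G \<Longrightarrow> Q (complement G) \<longleftrightarrow> P G"
  shows "unlabeled P \<approx> unlabeled Q"
proof (rule unlabeled_eqpoll[where R = "\<lambda>G H. H = complement G"])
  show "\<exists>H. simple_graph H \<and> Q H \<and> H = complement G" if "simple_graph G" "P G" for G
    using that assms simple_graph_complement by blast
  show "\<exists>G. simple_graph G \<and> P G \<and> H = complement G" if "simple_graph H" "Q H" for H
    using that assms[OF simple_graph_complement] simple_graph_complement complement_complement
    by metis
qed (simp add: isomorphic_complement_iff)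

lemma NG1_eqpoll_NG2: "of_order NG1 n \<approx> of_order NG2 n"
  unfolding NG1_def NG2_def of_order_unlabeled
  by (rule unlabeled_complement_eqpoll) (simp add: NG2_graph_complement)

lemma NG1_diff_NG2_eqpoll_NG2_diff_NG1: "of_order (NG1 - NG2) n \<approx> of_order (NG2 - NG1) n"
  unfolding NG1_def NG2_def of_order_unlabeled
    unlabeled_diff[OF iso_invariant_NG1 iso_invariant_NG2]
    unlabeled_diff[OF iso_invariant_NG2 iso_invariant_NG1]
  by (rule unlabeled_complement_eqpoll) (simp add: NG1_graph_complement NG2_graph_complement)

section \<open>Recursive count of the unbalanced split graphs\<close>

lemma of_order_disjoint:
  assumes "j \<noteq> k"
  shows "of_order (unlabeled P) j \<inter> of_order (unlabeled P) k = {}"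
proof -
  have "card (verts G) = card (verts G')" if X: "X \<in> unlabeled P" "G \<in> X" "G' \<in> X" for X G G'
  proof -
    obtain H where "X = iso_rel `` {H}"
      using X(1) unfolding unlabeled_conv_image by blast
    then have "isomorphic H G" "isomorphic H G'"
      using X(2,3) by (simp_all add: iso_rel_def)
    then show ?thesis
      using isomorphic_card by metis
  qed
  note card = this
  have "X \<notin> of_order (unlabeled P) k" if X: "X \<in> of_order (unlabeled P) j" for X
  proof
    assume "X \<in> of_order (unlabeled P) k"
    then obtain G where G: "X \<in> unlabeled P" "G \<in> X" "int (card (verts G)) = k"
      by (auto simp: of_order_def)
    moreover obtain G' where "G' \<in> X" "int (card (verts G')) = j"
      using X by (auto simp: of_order_def)
    ultimately show False
      using card[of X G G'] assms by simp
  qed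
  then show ?thesis
    by blast
qed

lemma unbalanced_conv_NG1_NG2: "Unbalanced = NG1 \<union> NG2"
proof -
  have "{G. simple_graph G \<and> (NG1_graph G \<or> NG2_graph G)} =
      {G :: nat graph. simple_graph G \<and> unbalanced_split G}"
    using NG1_or_NG2_graph_iff_unbalanced_split by (intro Collect_cong) blast
  then show ?thesis
    unfolding NG1_def NG2_def Unbalanced_def unlabeled_union by (simp add: unlabeled_def)
qed

text \<open>Passing from order \<open>m\<close> to \<open>m + 1\<close> adds exactly the split
  graphs of order \<open>m\<close>, which the summand \<open>NG1\<close> contributes.\<close>

lemma unbalanced_eqpoll_Split_upto: "of_order Unbalanced m \<approx> Split_upto (m - 1)"
proof (cases "m \<ge> 0")
  \<comment> \<open>For negative \<open>m\<close> both sides are empty, the right one because its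
    index range is.\<close>
  case False
  then have "of_order Unbalanced m = {}"
    by (auto simp: of_order_def)
  then show ?thesis
    using False by (simp add: Split_upto_def)
next
  case True
  then show ?thesis
  proof (induction m rule: int_ge_induct)
    case base
    \<comment> \<open>At order 0 there is no vertex to serve as a hub, and the indices from 0 to -1
      form an empty range.\<close>
    have "\<not> unbalanced_split G" if G: "simple_graph G" "int (card (verts G)) = 0" for G :: "nat graph"
    proof
      assume "unbalanced_split G"
      then obtain a K S where "hub_partition G {a} K S"
        unfolding unbalanced_split_iff_hub[OF G(1)] by blast
      from hub_partitionD(2)[OF this] show False
        using G(2) finite_verts[OF G(1)] by simp
    qed
    then have "{G :: nat graph. simple_graph G \<and> unbalanced_split G \<and> int (card (verts G)) = 0} = {}"
      by blast
    then have "of_order Unbalanced 0 = {}"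
      unfolding Unbalanced_def of_order_unlabeled unlabeled_conv_image[of "\<lambda>G. _ G \<and> _ G"] by simp
    then show ?case
      by (simp add: Split_upto_def)
  next
    case (step m)
    have "of_order Unbalanced (m + 1) = of_order NG1 (m + 1) \<union> of_order (NG2 - NG1) (m + 1)"
      unfolding unbalanced_conv_NG1_NG2 of_order_def by blast
    also have "\<dots> \<approx> of_order Split m \<union> Split_upto (m - 1)"
    proof (rule Un_eqpoll_cong)
      show "of_order NG1 (m + 1) \<approx> of_order Split m"
        using NG1_eqpoll_split[of "m + 1"] by simp
      \<comment> \<open>Hub removal is set up for \<open>NG1\<close> only, so the part outside it is
        first complemented.\<close>
      have "of_order (NG2 - NG1) (m + 1) \<approx> of_order (NG1 - NG2) (m + 1)"
        using NG1_diff_NG2_eqpoll_NG2_diff_NG1 by (rule eqpoll_sym)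
      also have "\<dots> \<approx> of_order Unbalanced m"
        using NG1_diff_NG2_eqpoll_unbalanced[of "m + 1"] by simp
      also note step.IH
      finally show "of_order (NG2 - NG1) (m + 1) \<approx> Split_upto (m - 1)" .
      show "disjnt (of_order NG1 (m + 1)) (of_order (NG2 - NG1) (m + 1))"
        by (auto simp: disjnt_def of_order_def)
      have "of_order Split m \<inter> of_order Split j = {}" if "j \<le> m - 1" for j
        unfolding Split_def using that by (intro of_order_disjoint) simp
      then show "disjnt (of_order Split m) (Split_upto (m - 1))"
        unfolding disjnt_def Split_upto_def Int_UN_distrib by simp
    qed
    also have "of_order Split m \<union> Split_upto (m - 1) = Split_upto m"
    proof -
      have "{0..m} = insert m {0..m - 1}"
        using step.hyps by auto
      then show ?thesis
        by (simp add: Split_upto_def)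
    qed
    finally show ?case by simp
  qed
qed

text \<open>Equipollence is an equivalence relation, so it suffices to compare every set of a row
  with one fixed set.\<close>

lemma pairwise_bijectiveI:
  assumes "\<And>Y. Y \<in> F \<Longrightarrow> X \<approx> Y"
  shows "pairwise_bijective F"
  unfolding pairwise_bijective_def eqpoll_def[symmetric]
proof (intro ballI)
  fix A B assume "A \<in> F" "B \<in> F"
  then show "A \<approx> B"
    using eqpoll_trans[OF eqpoll_sym] assms by blast
qed

theorem theorem4p1:
  fixes n :: int
  assumes "n > 0"
  shows "pairwise_bijective
           {of_order NG1 n, of_order NG2 n, of_order Split (n - 1)} \<and>
         pairwise_bijective
           {of_order (NG1 \<inter> NG2) n, of_order Balanced (n - 1)} \<and>
         pairwise_bijective
           {of_order (NG1 - NG2) n, of_order (NG2 - NG1) n,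
            of_order Unbalanced (n - 1), Split_upto (n - 2)} \<and>
         pairwise_bijective
           {of_order NG3 n, of_order Unbalanced (n - 4), Split_upto (n - 5)}"
proof (intro conjI)
  show "pairwise_bijective {of_order NG1 n, of_order NG2 n, of_order Split (n - 1)}"
    by (rule pairwise_bijectiveI[of _ "of_order NG1 n"]) (use NG1_eqpoll_NG2 NG1_eqpoll_split in auto)
  show "pairwise_bijective {of_order (NG1 \<inter> NG2) n, of_order Balanced (n - 1)}"
    by (rule pairwise_bijectiveI[of _ "of_order (NG1 \<inter> NG2) n"])
      (use NG1_inter_NG2_eqpoll_balanced in auto)
  \<comment> \<open>The unbalanced split graphs of order \<open>n - 1\<close> count all split graphs
    of strictly smaller order, hence the bound \<open>n - 2\<close>.\<close>
  have "of_order (NG1 - NG2) n \<approx> Split_upto (n - 2)"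
    using eqpoll_trans[OF NG1_diff_NG2_eqpoll_unbalanced unbalanced_eqpoll_Split_upto, of n] by simp
  then show "pairwise_bijective {of_order (NG1 - NG2) n, of_order (NG2 - NG1) n,
      of_order Unbalanced (n - 1), Split_upto (n - 2)}"
    by (intro pairwise_bijectiveI[of _ "of_order (NG1 - NG2) n"])
      (use NG1_diff_NG2_eqpoll_NG2_diff_NG1 NG1_diff_NG2_eqpoll_unbalanced in auto)
  have "of_order NG3 n \<approx> Split_upto (n - 5)"
    using eqpoll_trans[OF NG3_eqpoll_unbalanced unbalanced_eqpoll_Split_upto, of n] by simp
  then show "pairwise_bijective {of_order NG3 n, of_order Unbalanced (n - 4), Split_upto (n - 5)}"
    by (intro pairwise_bijectiveI[of _ "of_order NG3 n"]) (use NG3_eqpoll_unbalanced in auto)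
qed

end
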